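(* Let $X$ be a subshift generated by a recognizable and positive directive sequence $\boldsymbol\tau = (\tau_n \colon \mathcal A_{n+1}^* \to \mathcal A_n^* )_{n \geq 0}$. Then a real number $\alpha$ is a continuous eigenvalue of $X$ if and only if there exists a family of real numbers $(\rho_n(a) : n \geq 0,\ a \in \mathcal A_n)$ such that $$\sum_{n\geq0} \max\Big\{ \big\|\rho_n(u_0) - \rho_n(u_k)+ \alpha\, h_n(u_0\cdots u_{k-1}) \big\| : a \in \mathcal A_{n+2},\ u_0\cdots u_k \text{ a prefix of } \tau_n(\tau_{n+1}(a)),\ u_0,\dots,u_k\in\mathcal A_n \Big\} < \infty.$$
   Context: Alphabets are finite sets with at least two elements. $\mathcal A^*$ is the free monoid of finite words over $\mathcal A$ and $|w|$ is the length of $w$. $S$ is the shift map $S((x_k)_k)=(x_{k+1})_k$ on $\mathcal A^{\mathbb Z}$; a subshift is a closed set $X\subseteq\mathcal A^{\mathbb Z}$ with $S(X)=X$. A substitution $\tau:\mathcal A^*\to\mathcal B^*$ is a monoid morphism such that $\tau(a)$ is non-empty for every $a\in\mathcal A$ and every $b\in\mathcal B$ occurs in some $\tau(a)$; it acts on $x\in\mathcal A^{\mathbb Z}$ by concatenation, with $\tau(x_0)$ starting at coordinate $0$. A directive sequence $\boldsymbol\tau=(\tau_n)_{n\ge0}$ consists of substitutions $\tau_n:\mathcal A_{n+1}^*\to\mathcal A_n^*$. Put $\tau_{n,m}=\tau_n\circ\cdots\circ\tau_{m-1}$ for $m>n$. $X^{(n)}_{\boldsymbol\tau}$ is the set of $x\in\mathcal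 A_n^{\mathbb Z}$ such that every finite factor of $x$ occurs in $\tau_{n,m}(a)$ for some $m>n$ and $a\in\mathcal A_m$; $X_{\boldsymbol\tau}=X^{(0)}_{\boldsymbol\tau}$; $\boldsymbol\tau$ generates $X$ if $X=X_{\boldsymbol\tau}$. Heights: $h_n(u)=|\tau_{0,n}(u)|$ for $u\in\mathcal A_n^*$, $n\ge1$, and $h_0(u)=|u|$. $\boldsymbol\tau$ is positive if for all $n\ge0$, $a\in\mathcal A_n$, $b\in\mathcal A_{n+1}$, the letter $a$ occurs in $\tau_n(b)$. $\boldsymbol\tau$ is recognizable if, for every $n\ge1$, the sets $S^kB_n(a)$ ($a\in\mathcal A_n$, $0\le k<h_n(a)$) are pairwise disjoint, where $B_n(a)=\{\tau_{0,n}(x):x\in X^{(n)}_{\boldsymbol\tau},\ x_0=a\}$. A real number $\alpha$ is a continuous (additive) eigenvalue of a subshift $X$ if there is a continuous $g:X\to\mathbb R/\mathbb Z$ with $g(Sx)=g(x)+\alpha \pmod{\mathbb Z}$ for all $x\in X$. For $x\in\mathbb R$, $\|x\|$ is the distance from $x$ to the nearest integer. *)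

theory Defs
  imports "HOL-Analysis.Analysis" "HOL-Library.Sublist" "HOL-Library.Disjoint_Sets"
begin

text \<open>The additive circle: the reals modulo the integers, with the quotient topology.\<close>

quotient_type circle = real / "\<lambda>x y :: real. x - y \<in> \<int>"
proof (rule equivpI)
  show "reflp (\<lambda>x y :: real. x - y \<in> \<int>)"
    by (simp add: reflp_def)
  show "symp (\<lambda>x y :: real. x - y \<in> \<int>)"
    by (rule sympI) (drule Ints_minus, simp)
  show "transp (\<lambda>x y :: real. x - y \<in> \<int>)"
    by (rule transpI) (use Ints_add in force)
qed

instantiation circle :: ab_group_add
begin

lift_definition zero_circle :: circle is "0 :: real" .

lift_definition plus_circle :: "circle \<Rightarrow> circle \<Rightarrow> circle" is "(+)"
  using Ints_add by (metis add_diff_add)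

lift_definition uminus_circle :: "circle \<Rightarrow> circle" is uminus
  using Ints_minus by (metis minus_diff_minus)

lift_definition minus_circle :: "circle \<Rightarrow> circle \<Rightarrow> circle" is "(-)"
proof -
  fix a b c d :: real
  assume "a - b \<in> \<int>" "c - d \<in> \<int>"
  then have "(a - b) - (c - d) \<in> \<int>" by (rule Ints_diff)
  then show "(a - c) - (b - d) \<in> \<int>" by (simp add: algebra_simps)
qed

instance
  by standard (transfer; simp add: algebra_simps)+

end

lift_definition circle_of :: "real \<Rightarrow> circle" is "\<lambda>x. x" .

instantiation circle :: topological_space
begin

definition open_circle :: "circle set \<Rightarrow> bool" where
  "open_circle U \<longleftrightarrow> open (circle_of -` U)"

instance
  by standard (auto simp: open_circle_def vimage_Union)

end

definition int_dist :: "real \<Rightarrow> real" where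
  "int_dist x = \<bar>x - of_int (round x)\<bar>"

definition alphabet :: "'a set \<Rightarrow> bool" where
  "alphabet A \<longleftrightarrow> finite A \<and> card A \<ge> 2"

definition full_shift :: "'a set \<Rightarrow> (int \<Rightarrow> 'a) topology" where
  "full_shift A = product_topology (\<lambda>_. discrete_topology A) UNIV"

definition shift :: "(int \<Rightarrow> 'a) \<Rightarrow> int \<Rightarrow> 'a" where
  "shift x = (\<lambda>k. x (k + 1))"

definition subshift :: "'a set \<Rightarrow> (int \<Rightarrow> 'a) set \<Rightarrow> bool" where
  "subshift A X \<longleftrightarrow> closedin (full_shift A) X \<and> shift ` X = X"

definition continuous_eigenvalue :: "'a set \<Rightarrow> (int \<Rightarrow> 'a) set \<Rightarrow> real \<Rightarrow> bool" where
  "continuous_eigenvalue A X \<alpha> \<longleftrightarrow>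
     (\<exists>g :: (int \<Rightarrow> 'a) \<Rightarrow> circle.
        continuous_map (subtopology (full_shift A) X) euclidean g \<and>
        (\<forall>x\<in>X. g (shift x) = g x + circle_of \<alpha>))"

definition substitution :: "'a set \<Rightarrow> 'b set \<Rightarrow> ('a list \<Rightarrow> 'b list) \<Rightarrow> bool" where
  "substitution A B \<sigma> \<longleftrightarrow>
     \<sigma> \<in> lists A \<rightarrow> lists B \<and>
     \<sigma> [] = [] \<and>
     (\<forall>u\<in>lists A. \<forall>v\<in>lists A. \<sigma> (u @ v) = \<sigma> u @ \<sigma> v) \<and>
     (\<forall>a\<in>A. \<sigma> [a] \<noteq> []) \<and>
     (\<forall>b\<in>B. \<exists>a\<in>A. b \<in> set (\<sigma> [a]))"

text \<open>
  Action of a substitution on two-sided sequences, with the image of \<open>x 0\<close> starting at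
  coordinate 0. Since letters have non-empty images, the words \<open>\<sigma> (x 0 \<dots> x j)\<close> and
  \<open>\<sigma> (x j \<dots> x (-1))\<close> are long enough to contain coordinate \<open>j\<close>, for \<open>j \<ge> 0\<close> and \<open>j < 0\<close>
  respectively; the second word occupies the coordinates up to \<open>-1\<close>.
\<close>

definition subst_seq :: "('a list \<Rightarrow> 'b list) \<Rightarrow> (int \<Rightarrow> 'a) \<Rightarrow> int \<Rightarrow> 'b" where
  "subst_seq \<sigma> x j =
     (if j \<ge> 0 then \<sigma> (map x [0..j]) ! nat j
      else (let w = \<sigma> (map x [j..-1]) in w ! nat (int (length w) + j)))"

text \<open>
  All alphabets \<open>A n\<close> lie in one ambient type; this is no restriction, as their union is countable.
\<close>

definition directive_sequence :: "(nat \<Rightarrow> 'a set) \<Rightarrow> (nat \<Rightarrow> 'a list \<Rightarrow> 'a list) \<Rightarrow> bool" where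
  "directive_sequence A \<tau> \<longleftrightarrow>
     (\<forall>n. alphabet (A n)) \<and> (\<forall>n. substitution (A (n + 1)) (A n) (\<tau> n))"

text \<open>The composition \<open>\<tau> n \<circ> \<dots> \<circ> \<tau> (m - 1)\<close>; it is the identity for \<open>m = n\<close>.\<close>

definition subst_comp :: "(nat \<Rightarrow> 'a list \<Rightarrow> 'a list) \<Rightarrow> nat \<Rightarrow> nat \<Rightarrow> 'a list \<Rightarrow> 'a list" where
  "subst_comp \<tau> n m = foldr (\<lambda>i f. \<tau> i \<circ> f) [n..<m] id"

definition level_shift ::
    "(nat \<Rightarrow> 'a set) \<Rightarrow> (nat \<Rightarrow> 'a list \<Rightarrow> 'a list) \<Rightarrow> nat \<Rightarrow> (int \<Rightarrow> 'a) set" where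
  "level_shift A \<tau> n =
     {x. (\<forall>k. x k \<in> A n) \<and>
         (\<forall>i j. \<exists>m>n. \<exists>a\<in>A m. sublist (map x [i..j]) (subst_comp \<tau> n m [a]))}"

definition generates ::
    "(nat \<Rightarrow> 'a set) \<Rightarrow> (nat \<Rightarrow> 'a list \<Rightarrow> 'a list) \<Rightarrow> (int \<Rightarrow> 'a) set \<Rightarrow> bool" where
  "generates A \<tau> X \<longleftrightarrow> X = level_shift A \<tau> 0"

definition height :: "(nat \<Rightarrow> 'a list \<Rightarrow> 'a list) \<Rightarrow> nat \<Rightarrow> 'a list \<Rightarrow> nat" where
  "height \<tau> n u = length (subst_comp \<tau> 0 n u)"

definition positive_seq :: "(nat \<Rightarrow> 'a set) \<Rightarrow> (nat \<Rightarrow> 'a list \<Rightarrow> 'a list) \<Rightarrow> bool" where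
  "positive_seq A \<tau> \<longleftrightarrow> (\<forall>n. \<forall>a\<in>A n. \<forall>b\<in>A (n + 1). a \<in> set (\<tau> n [b]))"

definition tower_base ::
    "(nat \<Rightarrow> 'a set) \<Rightarrow> (nat \<Rightarrow> 'a list \<Rightarrow> 'a list) \<Rightarrow> nat \<Rightarrow> 'a \<Rightarrow> (int \<Rightarrow> 'a) set" where
  "tower_base A \<tau> n a = subst_seq (subst_comp \<tau> 0 n) ` {x \<in> level_shift A \<tau> n. x 0 = a}"

definition recognizable :: "(nat \<Rightarrow> 'a set) \<Rightarrow> (nat \<Rightarrow> 'a list \<Rightarrow> 'a list) \<Rightarrow> bool" where
  "recognizable A \<tau> \<longleftrightarrow>
     (\<forall>n\<ge>1. disjoint_family_on (\<lambda>(a, k). (shift ^^ k) ` tower_base A \<tau> n a)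
              (SIGMA a:A n. {..<height \<tau> n [a]}))"

end

theory Submission imports Defs begin

text \<open>
  Write \<open>\<sigma> n\<close> for the composition \<open>\<tau> 0 \<circ> \<dots> \<circ> \<tau> (n - 1)\<close>, \<open>B n a\<close> for \<open>tower_base A \<tau> n a\<close> and \<open>S\<close>
  for the shift. The tower of a letter \<open>a\<close> of level \<open>n\<close> consists of the sets \<open>S\<^sup>p B n a\<close> with
  \<open>p < height \<tau> n [a]\<close>. By compactness the towers of a level cover \<open>X\<close> (\<open>in_tower_exists\<close>) and are
  closed (\<open>in_tower_closed\<close>). A point at position \<open>q\<close> of a tower of level \<open>n + 1\<close> with letter \<open>b\<close>
  is at position \<open>p\<close> of a tower of level \<open>n\<close> whose letter is a letter of \<open>\<tau> n [b]\<close>, and \<open>q - p\<close> is the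
  height of the word that precedes this letter in \<open>\<tau> n [b]\<close> (\<open>in_tower_descend\<close>). The numbers in the
  series measure how far \<open>\<rho> n\<close>, taken as a list of values on the bases of level \<open>n\<close>, is from
  growing by \<open>\<alpha>\<close> at each application of the shift inside the towers of level \<open>n + 2\<close>.

  Let \<open>g\<close> be a continuous eigenfunction. It oscillates little on \<open>B n a\<close> for large \<open>n\<close>
  (\<open>eigenfunction_tower_base\<close>), so real lifts of \<open>g\<close> exist there, and \<open>\<rho> n a\<close> is taken to be the
  supremum of such a lift. The deficit of a point \<open>w\<close> of \<open>B n a\<close>, which is \<open>\<rho> n a - g w\<close>, is then
  non-negative and bounded. When one passes from \<open>B (n + 1) b\<close> to the base of a letter of
  \<open>\<tau> n [b]\<close>, the deficit grows by a cost that depends only on the place of the letter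
  (\<open>deficit_descend\<close>), and the choice of a supremum makes all costs non-negative
  (\<open>edge_cost_nonneg\<close>). Summing the largest costs need not
  correspond to a point, since consecutive worst passages may not fit together. Positivity repairs
  this at the price of every other level: two worst passages that are two levels apart can be joined
  by a passage between them (\<open>descend_worst_edges\<close>). Hence the sums of the largest costs over the
  even and over the odd levels are bounded by the largest deficit, and the term of the series at \<open>n\<close>
  is at most the sum of the largest costs of the levels \<open>n\<close> and \<open>n + 1\<close>.

  Conversely, let the series converge. By recognizability each point \<open>x\<close> has exactly one letter \<open>a\<close>
  and position \<open>p\<close> at each level \<open>n \<ge> 1\<close>, and closedness of the towers makes them locally constant in
  \<open>x\<close>. So \<open>\<rho> n a + \<alpha> p\<close> is a continuous function of \<open>x\<close>. Its change from level \<open>n\<close> to level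
  \<open>n + 1\<close> is bounded by the terms of the series up to a constant that does not depend on \<open>x\<close>
  (\<open>first_letter_comparison\<close> and \<open>column_error\<close>; both use that by positivity all letters occur in one
  tower). After removal of these constants the functions converge uniformly on the circle. The
  limit increases by \<open>\<alpha>\<close> under the shift at each point that is not on top of all its towers,
  because from some level on the shift only raises the position by one. Such points are dense
  (\<open>below_top_dense\<close>), and continuity gives the equation everywhere.
\<close>

section \<open>Words and substitutions\<close>

lemma substitution_Nil: "substitution A B \<sigma> \<Longrightarrow> \<sigma> [] = []"
  by (simp add: substitution_def)

lemma substitution_append:
  "\<lbrakk>substitution A B \<sigma>; u \<in> lists A; v \<in> lists A\<rbrakk> \<Longrightarrow> \<sigma> (u @ v) = \<sigma> u @ \<sigma> v"
  by (simp add: substitution_def)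

lemma substitution_Cons:
  "\<lbrakk>substitution A B \<sigma>; a \<in> A; v \<in> lists A\<rbrakk> \<Longrightarrow> \<sigma> (a # v) = \<sigma> [a] @ \<sigma> v"
  using substitution_append[of A B \<sigma> "[a]" v] by simp

lemma substitution_lists: "\<lbrakk>substitution A B \<sigma>; u \<in> lists A\<rbrakk> \<Longrightarrow> \<sigma> u \<in> lists B"
  by (auto simp: substitution_def Pi_iff)

lemma substitution_letter: "\<lbrakk>substitution A B \<sigma>; a \<in> A\<rbrakk> \<Longrightarrow> \<sigma> [a] \<noteq> []"
  by (simp add: substitution_def)

lemma substitution_length_ge:
  assumes "substitution A B \<sigma>" "u \<in> lists A"
  shows "length u \<le> length (\<sigma> u)"
  using assms(2)
proof (induction u)
  case (Cons a u)
  then show ?case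
    using substitution_Cons[OF assms(1), of a u] substitution_letter[OF assms(1), of a]
    by (cases "\<sigma> [a]") auto
qed simp

lemma substitution_length_le:
  assumes "substitution A B \<sigma>" "u \<in> lists A" "\<And>a. a \<in> A \<Longrightarrow> length (\<sigma> [a]) \<le> H"
  shows "length (\<sigma> u) \<le> length u * H"
  using assms(2)
proof (induction u)
  case Nil
  then show ?case by (simp add: substitution_Nil[OF assms(1)])
next
  case (Cons a u)
  then show ?case
    using substitution_Cons[OF assms(1), of a u] assms(3)[of a] by auto
qed

lemma substitution_sublist:
  assumes "substitution A B \<sigma>" "v \<in> lists A" "sublist u v"
  shows "sublist (\<sigma> u) (\<sigma> v)"
proof -
  obtain p s where v: "v = p @ u @ s" using assms(3) by (auto simp: sublist_def)
  then have "\<sigma> v = \<sigma> p @ \<sigma> u @ \<sigma> s"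
    using assms by (auto simp: substitution_append[OF assms(1)])
  then show ?thesis by (metis sublist_appendI)
qed

lemma substitution_comp:
  assumes s: "substitution B C \<sigma>" and r: "substitution A B \<rho>"
  shows "substitution A C (\<sigma> \<circ> \<rho>)"
  unfolding substitution_def
proof (intro conjI ballI)
  show "\<sigma> \<circ> \<rho> \<in> lists A \<rightarrow> lists C"
    using substitution_lists[OF s] substitution_lists[OF r] by auto
  show "(\<sigma> \<circ> \<rho>) [] = []" using substitution_Nil[OF s] substitution_Nil[OF r] by simp
  show "(\<sigma> \<circ> \<rho>) (u @ v) = (\<sigma> \<circ> \<rho>) u @ (\<sigma> \<circ> \<rho>) v" if "u \<in> lists A" "v \<in> lists A" for u v
    using that by (simp add: substitution_append[OF r] substitution_append[OF s] substitution_lists[OF r])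
  show "(\<sigma> \<circ> \<rho>) [a] \<noteq> []" if "a \<in> A" for a
  proof -
    have "length (\<rho> [a]) \<le> length (\<sigma> (\<rho> [a]))"
      using that by (intro substitution_length_ge[OF s] substitution_lists[OF r]) auto
    then show ?thesis using substitution_letter[OF r that] by auto
  qed
  show "\<exists>a\<in>A. c \<in> set ((\<sigma> \<circ> \<rho>) [a])" if c: "c \<in> C" for c
  proof -
    obtain b where b: "b \<in> B" "c \<in> set (\<sigma> [b])" using s c by (auto simp: substitution_def)
    obtain a where a: "a \<in> A" "b \<in> set (\<rho> [a])" using r b by (auto simp: substitution_def)
    have "sublist [b] (\<rho> [a])" using a(2) by (metis append_Cons append_Nil split_list sublist_appendI)
    then have "sublist (\<sigma> [b]) (\<sigma> (\<rho> [a]))"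
      using a by (intro substitution_sublist[OF s] substitution_lists[OF r]) auto
    then show ?thesis using a(1) b(2) set_mono_sublist by fastforce
  qed
qed

lemma substitution_id: "substitution A A id"
  by (auto simp: substitution_def)

text \<open>
  Desubstitution of a position: each coordinate of an image word lies in the image of exactly
  one letter. Every passage between consecutive levels of the towers goes through this lemma.
\<close>

lemma substitution_position:
  assumes s: "substitution A B \<sigma>" and u: "u \<in> lists A" and t: "t < length (\<sigma> u)"
  obtains i j where "i < length u" "j < length (\<sigma> [u ! i])" "t = length (\<sigma> (take i u)) + j"
    "\<sigma> u ! t = \<sigma> [u ! i] ! j" "take t (\<sigma> u) = \<sigma> (take i u) @ take j (\<sigma> [u ! i])"
proof -
  have "\<exists>i j. i < length u \<and> j < length (\<sigma> [u ! i]) \<and> t = length (\<sigma> (take i u)) + j \<and>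
    \<sigma> u ! t = \<sigma> [u ! i] ! j \<and> take t (\<sigma> u) = \<sigma> (take i u) @ take j (\<sigma> [u ! i])"
    using u t
  proof (induction u rule: rev_induct)
    case Nil
    then show ?case by (simp add: substitution_Nil[OF s])
  next
    case (snoc a u)
    have eq: "\<sigma> (u @ [a]) = \<sigma> u @ \<sigma> [a]" using snoc.prems by (intro substitution_append[OF s]) auto
    show ?case
    proof (cases "t < length (\<sigma> u)")
      case True
      then obtain i j where "i < length u \<and> j < length (\<sigma> [u ! i]) \<and> t = length (\<sigma> (take i u)) + j \<and>
          \<sigma> u ! t = \<sigma> [u ! i] ! j \<and> take t (\<sigma> u) = \<sigma> (take i u) @ take j (\<sigma> [u ! i])"
        using snoc by auto
      then show ?thesis using True eq by (intro exI[of _ i] exI[of _ j]) (auto simp: nth_append)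
    next
      case False
      then show ?thesis using snoc.prems eq
        by (intro exI[of _ "length u"] exI[of _ "t - length (\<sigma> u)"]) (auto simp: nth_append)
    qed
  qed
  then show ?thesis using that by blast
qed

lemma substitution_prefix_of_position:
  assumes s: "substitution A B \<sigma>" and u: "u \<in> lists A" and i: "i < length u" and j: "j < length (\<sigma> [u ! i])"
  shows "length (\<sigma> (take i u)) + j < length (\<sigma> u)"
    and "\<sigma> u ! (length (\<sigma> (take i u)) + j) = \<sigma> [u ! i] ! j"
    and "take (length (\<sigma> (take i u)) + j) (\<sigma> u) = \<sigma> (take i u) @ take j (\<sigma> [u ! i])"
proof -
  have u': "u = take i u @ [u ! i] @ drop (Suc i) u"
    using i by (simp add: id_take_nth_drop)
  have l: "take i u \<in> lists A" "[u ! i] \<in> lists A" "drop (Suc i) u \<in> lists A"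
    using u i by (auto simp: in_lists_conv_set dest: in_set_takeD in_set_dropD)
  then have "\<sigma> (take i u @ [u ! i] @ drop (Suc i) u) = \<sigma> (take i u) @ \<sigma> [u ! i] @ \<sigma> (drop (Suc i) u)"
    by (subst substitution_append[OF s]) (auto simp del: append_Cons simp: substitution_append[OF s, of "[u ! i]"])
  then have "\<sigma> u = \<sigma> (take i u) @ \<sigma> [u ! i] @ \<sigma> (drop (Suc i) u)" using u' by metis
  then show "length (\<sigma> (take i u)) + j < length (\<sigma> u)"
    "\<sigma> u ! (length (\<sigma> (take i u)) + j) = \<sigma> [u ! i] ! j"
    "take (length (\<sigma> (take i u)) + j) (\<sigma> u) = \<sigma> (take i u) @ take j (\<sigma> [u ! i])"
    using j by (auto simp: nth_append)
qed

section \<open>Substitutions acting on two-sided sequences\<close>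

definition word :: "(int \<Rightarrow> 'a) \<Rightarrow> int \<Rightarrow> nat \<Rightarrow> 'a list" where
  "word x l n = map (\<lambda>i. x (l + int i)) [0..<n]"

lemma length_word [simp]: "length (word x l n) = n"
  by (simp add: word_def)

lemma nth_word [simp]: "i < n \<Longrightarrow> word x l n ! i = x (l + int i)"
  by (simp add: word_def)

lemma take_word [simp]: "i \<le> n \<Longrightarrow> take i (word x l n) = word x l i"
  by (rule nth_equalityI) auto

lemma word_add: "word x l (m + n) = word x l m @ word x (l + int m) n"
  by (rule nth_equalityI) (auto simp: nth_append)

lemma word_0 [simp]: "word x l 0 = []"
  by (simp add: word_def)

lemma word_1: "word x l (Suc 0) = [x l]"
  by (simp add: word_def)

lemma word_in_lists: "range x \<subseteq> A \<Longrightarrow> word x l n \<in> lists A"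
  using rangeI[of x] by (auto simp: word_def subset_iff)

lemma map_upto_eq_word: "map x [i..j] = word x i (nat (j - i + 1))"
  by (rule nth_equalityI) auto

lemma funpow_shift: "(shift ^^ i) x = (\<lambda>k. x (k + int i))"
  by (induction i) (auto simp: shift_def algebra_simps)

text \<open>
  The coordinate of \<open>subst_seq \<sigma> x\<close> at which the image of \<open>x k\<close> begins. Together with
  \<open>subst_seq_letter\<close> and \<open>start_cover\<close> it replaces the two cases in the definition of
  \<open>subst_seq\<close> by a description that is uniform in the sign of the coordinate.
\<close>

definition start :: "('a list \<Rightarrow> 'b list) \<Rightarrow> (int \<Rightarrow> 'a) \<Rightarrow> int \<Rightarrow> int" where
  "start \<sigma> x k = (if k \<ge> 0 then int (length (\<sigma> (word x 0 (nat k))))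
                  else - int (length (\<sigma> (word x k (nat (- k))))))"

lemma start_add:
  assumes s: "substitution A B \<sigma>" and x: "range x \<subseteq> A"
  shows "start \<sigma> x (k + int n) = start \<sigma> x k + int (length (\<sigma> (word x k n)))"
proof -
  have ap: "\<sigma> (word x l (m + n)) = \<sigma> (word x l m) @ \<sigma> (word x (l + int m) n)" for l m n
    by (simp add: word_add substitution_append[OF s] word_in_lists[OF x])
  consider "k \<ge> 0" | "k < 0" "k + int n < 0" | "k < 0" "k + int n \<ge> 0" by linarith
  then show ?thesis
  proof cases
    case 1
    then show ?thesis using ap[of 0 "nat k" n] by (simp add: start_def nat_add_distrib)
  next
    case 2
    then show ?thesis using ap[of k n "nat (- k - int n)"]
      by (simp add: start_def) (simp add: nat_diff_distrib algebra_simps)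
  next
    case 3
    then have "n = nat (- k) + nat (k + int n)" by simp
    then have "length (\<sigma> (word x k n)) = length (\<sigma> (word x k (nat (- k)))) + length (\<sigma> (word x 0 (nat (k + int n))))"
      using ap[of k "nat (- k)" "nat (k + int n)"] 3 by (metis add.right_inverse int_nat_eq length_append neg_0_le_iff_le nle_le linorder_not_le)
    then show ?thesis using 3 by (simp add: start_def)
  qed
qed

lemma start_0 [simp]: "substitution A B \<sigma> \<Longrightarrow> start \<sigma> x 0 = 0"
  by (simp add: start_def substitution_Nil)

lemma start_ge:
  assumes s: "substitution A B \<sigma>" and x: "range x \<subseteq> A" and k: "k \<ge> 0"
  shows "k \<le> start \<sigma> x k" "start \<sigma> x (- k) \<le> - k"
  using k substitution_length_ge[OF s word_in_lists[OF x, of 0 "nat k"]]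
    substitution_length_ge[OF s word_in_lists[OF x, of "- k" "nat k"]]
  by (cases "k = 0"; auto simp: start_def substitution_Nil[OF s])+

text \<open>
  For a negative coordinate the letter is read off from the right end of a word that may begin
  to the left of \<open>k\<close>; the part that precedes \<open>x k\<close> cancels in the index.
\<close>

lemma subst_seq_letter:
  assumes s: "substitution A B \<sigma>" and x: "range x \<subseteq> A" and j: "j < length (\<sigma> [x k])"
  shows "subst_seq \<sigma> x (start \<sigma> x k + int j) = \<sigma> [x k] ! j"
proof -
  define J where "J = start \<sigma> x k + int j"
  have ap: "\<sigma> (word x l (m + n)) = \<sigma> (word x l m) @ \<sigma> (word x (l + int m) n)" for l m n
    by (simp add: word_add substitution_append[OF s] word_in_lists[OF x])
  show ?thesis
  proof (cases "k \<ge> 0")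
    case True
    then have J: "k \<le> J" using start_ge[OF s x True] by (simp add: J_def)
    have nJ: "nat J = length (\<sigma> (word x 0 (nat k))) + j"
      using True by (simp add: J_def start_def nat_add_distrib)
    have "map x [0..J] = word x 0 (nat k + (1 + nat (J - k)))"
      using J True by (simp add: map_upto_eq_word) (rule arg_cong[where f = "word x 0"], linarith)
    then have "\<sigma> (map x [0..J]) = \<sigma> (word x 0 (nat k)) @ \<sigma> [x k] @ \<sigma> (word x (k + 1) (nat (J - k)))"
      using True by (simp only: ap) (simp add: word_1)
    then have "\<sigma> (map x [0..J]) ! nat J = \<sigma> [x k] ! j"
      using j by (simp add: nJ nth_append)
    then show ?thesis using J True by (simp add: subst_seq_def J_def[symmetric])
  next
    case False
    have w: "\<sigma> (word x k (nat (- k))) = \<sigma> [x k] @ \<sigma> (word x (k + 1) (nat (- k - 1)))"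
      using False ap[of k 1 "nat (- k - 1)"] by (simp add: word_1) (simp add: Suc_nat_eq_nat_zadd1)
    have len: "nat (- k - 1) \<le> length (\<sigma> (word x (k + 1) (nat (- k - 1))))"
      using substitution_length_ge[OF s word_in_lists[OF x, of "k + 1" "nat (- k - 1)"]] by simp
    have J0: "J \<le> k" "J < 0" using False j w len by (auto simp: J_def start_def)
    have "map x [J..-1] = word x J (nat (k - J) + nat (- k))"
      using J0 False by (simp add: map_upto_eq_word nat_add_distrib[symmetric])
    then have "\<sigma> (map x [J..-1]) = \<sigma> (word x J (nat (k - J))) @ \<sigma> (word x k (nat (- k)))"
      using J0 by (simp only: ap) simp
    moreover have "nat (int (length (\<sigma> (word x J (nat (k - J))) @ \<sigma> (word x k (nat (- k))))) + J)
        = length (\<sigma> (word x J (nat (k - J)))) + j"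
      using False by (simp add: J_def start_def)
    ultimately have "subst_seq \<sigma> x J = \<sigma> [x k] ! j"
      using j J0 w unfolding subst_seq_def Let_def by (simp add: nth_append)
    then show ?thesis by (simp add: J_def)
  qed
qed

lemma subst_seq_word:
  assumes s: "substitution A B \<sigma>" and x: "range x \<subseteq> A" and t: "t < length (\<sigma> (word x l n))"
  shows "subst_seq \<sigma> x (start \<sigma> x l + int t) = \<sigma> (word x l n) ! t"
proof -
  obtain i j where ij: "i < length (word x l n)" "j < length (\<sigma> [word x l n ! i])"
    "t = length (\<sigma> (take i (word x l n))) + j"
    "\<sigma> (word x l n) ! t = \<sigma> [word x l n ! i] ! j"
    by (rule substitution_position[OF s word_in_lists[OF x] t])
  then have "start \<sigma> x l + int t = start \<sigma> x (l + int i) + int j"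
    by (simp add: start_add[OF s x])
  then have "subst_seq \<sigma> x (start \<sigma> x l + int t) = subst_seq \<sigma> x (start \<sigma> x (l + int i) + int j)"
    by (simp only:)
  then show ?thesis using ij(1,2,4) subst_seq_letter[OF s x, of j "l + int i"] by simp
qed

lemma word_subst_seq:
  assumes s: "substitution A B \<sigma>" and x: "range x \<subseteq> A"
  shows "word (subst_seq \<sigma> x) (start \<sigma> x l) (length (\<sigma> (word x l n))) = \<sigma> (word x l n)"
  using subst_seq_word[OF s x] by (intro nth_equalityI) auto

lemma start_cover:
  assumes s: "substitution A B \<sigma>" and x: "range x \<subseteq> A"
  obtains k j where "t = start \<sigma> x k + int j" "j < length (\<sigma> [x k])"
proof -
  define l n where "l = - \<bar>t\<bar>" and "n = nat (2 * \<bar>t\<bar> + 1)"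
  define r where "r = nat (t - start \<sigma> x l)"
  have l: "start \<sigma> x l \<le> t" using start_ge(2)[OF s x, of "\<bar>t\<bar>"] by (auto simp: l_def)
  have "start \<sigma> x (l + int n) > t"
    using start_ge(1)[OF s x, of "\<bar>t\<bar> + 1"] by (auto simp: l_def n_def algebra_simps)
  then have "r < length (\<sigma> (word x l n))" using l by (simp add: start_add[OF s x] r_def)
  then obtain i j where "i < length (word x l n)" "j < length (\<sigma> [word x l n ! i])"
    "r = length (\<sigma> (take i (word x l n))) + j"
    by (rule substitution_position[OF s word_in_lists[OF x]])
  then have "t = start \<sigma> x (l + int i) + int j" "j < length (\<sigma> [x (l + int i)])"
    using l by (auto simp: start_add[OF s x] r_def)
  then show ?thesis by (rule that)
qed

lemma subst_seq_eqI:
  assumes s: "substitution A B \<sigma>" and x: "range x \<subseteq> A"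
    and f: "\<And>k j. j < length (\<sigma> [x k]) \<Longrightarrow> f (start \<sigma> x k + int j) = \<sigma> [x k] ! j"
  shows "subst_seq \<sigma> x = f"
proof
  fix t
  obtain k j where "t = start \<sigma> x k + int j" "j < length (\<sigma> [x k])" by (rule start_cover[OF s x])
  then show "subst_seq \<sigma> x t = f t" using f subst_seq_letter[OF s x] by simp
qed

lemma range_subst_seq:
  assumes s: "substitution A B \<sigma>" and x: "range x \<subseteq> A"
  shows "range (subst_seq \<sigma> x) \<subseteq> B"
proof
  fix b assume "b \<in> range (subst_seq \<sigma> x)"
  then obtain t where t: "b = subst_seq \<sigma> x t" by auto
  obtain k j where kj: "t = start \<sigma> x k + int j" "j < length (\<sigma> [x k])" by (rule start_cover[OF s x])
  then have "b = \<sigma> [x k] ! j" using subst_seq_letter[OF s x] t by simp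
  moreover have "\<sigma> [x k] \<in> lists B" using x by (intro substitution_lists[OF s]) auto
  ultimately show "b \<in> B" using kj(2) by (auto simp: in_lists_conv_set)
qed

text \<open>Moving the origin of \<open>x\<close> by \<open>i\<close> letters moves the origin of the image by the length of
  their images.\<close>

lemma start_funpow_shift:
  assumes s: "substitution A B \<sigma>" and x: "range x \<subseteq> A"
  shows "start \<sigma> ((shift ^^ i) x) k = start \<sigma> x (k + int i) - start \<sigma> x (int i)"
proof (cases "k \<ge> 0")
  case True
  then show ?thesis using start_add[OF s x, of "int i" "nat k"]
    by (simp add: start_def[of \<sigma> "\<lambda>k. x (k + int i)"] word_def funpow_shift algebra_simps)
next
  case False
  then show ?thesis using start_add[OF s x, of "k + int i" "nat (- k)"]
    by (simp add: start_def[of \<sigma> "\<lambda>k. x (k + int i)"] word_def funpow_shift algebra_simps)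
qed

lemma subst_seq_funpow_shift:
  assumes s: "substitution A B \<sigma>" and x: "range x \<subseteq> A"
  shows "subst_seq \<sigma> ((shift ^^ i) x) = (shift ^^ length (\<sigma> (word x 0 i))) (subst_seq \<sigma> x)"
proof (rule subst_seq_eqI[OF s])
  show "range ((shift ^^ i) x) \<subseteq> A" using x by (auto simp: funpow_shift)
  fix k j assume j: "j < length (\<sigma> [(shift ^^ i) x k])"
  have "start \<sigma> x (int i) = int (length (\<sigma> (word x 0 i)))"
    by (simp add: start_def)
  then have eq: "start \<sigma> ((shift ^^ i) x) k + int j + int (length (\<sigma> (word x 0 i))) = start \<sigma> x (k + int i) + int j"
    by (simp add: start_funpow_shift[OF s x])
  have "(shift ^^ length (\<sigma> (word x 0 i))) (subst_seq \<sigma> x) (start \<sigma> ((shift ^^ i) x) k + int j)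
      = subst_seq \<sigma> x (start \<sigma> x (k + int i) + int j)"
    by (simp only: funpow_shift[of "length (\<sigma> (word x 0 i))"] eq)
  then show "(shift ^^ length (\<sigma> (word x 0 i))) (subst_seq \<sigma> x) (start \<sigma> ((shift ^^ i) x) k + int j)
      = \<sigma> [(shift ^^ i) x k] ! j"
    using j subst_seq_letter[OF s x, of j "k + int i"] by (simp add: funpow_shift[of i])
qed

lemma start_comp:
  assumes s: "substitution B C \<sigma>" and r: "substitution A B \<rho>" and x: "range x \<subseteq> A"
  shows "start (\<sigma> \<circ> \<rho>) x k = start \<sigma> (subst_seq \<rho> x) (start \<rho> x k)"
proof (cases "k \<ge> 0")
  case True
  then show ?thesis
    using word_subst_seq[OF r x, of 0 "nat k"] r by (simp add: start_def substitution_Nil)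
next
  case False
  have "nat (- k) \<le> length (\<rho> (word x k (nat (- k))))"
    using substitution_length_ge[OF r word_in_lists[OF x, of k "nat (- k)"]] by simp
  then have "\<rho> (word x k (nat (- k))) \<noteq> []" using False by (cases "\<rho> (word x k (nat (- k)))") auto
  then show ?thesis
    using False word_subst_seq[OF r x, of k "nat (- k)"] by (simp add: start_def)
qed

lemma subst_seq_comp:
  assumes s: "substitution B C \<sigma>" and r: "substitution A B \<rho>" and x: "range x \<subseteq> A"
  shows "subst_seq (\<sigma> \<circ> \<rho>) x = subst_seq \<sigma> (subst_seq \<rho> x)"
proof (rule subst_seq_eqI[OF substitution_comp[OF s r] x])
  fix k j assume j: "j < length ((\<sigma> \<circ> \<rho>) [x k])"
  have w: "word (subst_seq \<rho> x) (start \<rho> x k) (length (\<rho> [x k])) = \<rho> [x k]"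
    using word_subst_seq[OF r x, of k 1] by (simp add: word_1)
  show "subst_seq \<sigma> (subst_seq \<rho> x) (start (\<sigma> \<circ> \<rho>) x k + int j) = (\<sigma> \<circ> \<rho>) [x k] ! j"
    using j subst_seq_word[OF s range_subst_seq[OF r x], of j "start \<rho> x k" "length (\<rho> [x k])"]
    by (simp add: w start_comp[OF s r x])
qed

text \<open>
  Images of letters are non-empty, so a coordinate of the image depends only on the coordinates of
  \<open>x\<close> up to the same absolute value. This is the continuity of the action, with an explicit modulus.
\<close>

lemma subst_seq_cong:
  assumes "\<And>k. \<bar>k\<bar> \<le> \<bar>j\<bar> \<Longrightarrow> x k = y k"
  shows "subst_seq \<sigma> x j = subst_seq \<sigma> y j"
proof -
  have "map x [0..j] = map y [0..j]" if "j \<ge> 0" using assms that by auto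
  moreover have "map x [j..-1] = map y [j..-1]" if "j < 0" using assms that by auto
  ultimately show ?thesis by (auto simp: subst_seq_def simp del: map_eq_conv)
qed

section \<open>Compactness of the full shift\<close>

definition agree :: "nat \<Rightarrow> (int \<Rightarrow> 'a) \<Rightarrow> (int \<Rightarrow> 'a) \<Rightarrow> bool" where
  "agree N x y \<longleftrightarrow> (\<forall>k. \<bar>k\<bar> \<le> int N \<longrightarrow> x k = y k)"

lemma agree_mono: "agree N x y \<Longrightarrow> M \<le> N \<Longrightarrow> agree M x y"
  by (auto simp: agree_def)

lemma agree_sym: "agree N x y \<Longrightarrow> agree N y x"
  by (auto simp: agree_def)

lemma agree_trans: "agree N x y \<Longrightarrow> agree N y z \<Longrightarrow> agree N x z"
  by (auto simp: agree_def)

lemma topspace_full_shift [simp]: "topspace (full_shift A) = {x. range x \<subseteq> A}"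
  by (auto simp: full_shift_def PiE_def extensional_def)

lemma openin_cylinder:
  assumes "range x \<subseteq> A"
  shows "openin (full_shift A) {y. range y \<subseteq> A \<and> agree N x y}"
proof -
  define S where "S = (\<lambda>k::int. if \<bar>k\<bar> \<le> int N then {x k} else A)"
  have "(range y \<subseteq> A \<and> agree N x y) = (\<forall>k. y k \<in> S k)" for y
    using assms by (auto simp: S_def agree_def image_subset_iff split: if_splits; metis)
  then have "{y. range y \<subseteq> A \<and> agree N x y} = (\<Pi>\<^sub>E k\<in>UNIV. S k)"
    by (simp add: PiE_def extensional_def Pi_def)
  moreover have "finite {k \<in> UNIV. S k \<noteq> topspace (discrete_topology A)}"
    by (rule finite_subset[of _ "{- int N..int N}"]) (auto simp: S_def split: if_splits)
  moreover have "S k \<subseteq> A" for k using assms by (auto simp: S_def)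
  ultimately show ?thesis
    unfolding full_shift_def by (simp add: openin_PiE_gen)
qed

lemma openin_full_shift_cylinder:
  assumes "openin (full_shift A) U" "x \<in> U"
  obtains N where "\<And>y. range y \<subseteq> A \<Longrightarrow> agree N x y \<Longrightarrow> y \<in> U"
proof -
  obtain V where V: "finite {k \<in> UNIV. V k \<noteq> topspace (discrete_topology A)}"
      "x \<in> Pi\<^sub>E UNIV V" "Pi\<^sub>E UNIV V \<subseteq> U"
    using assms unfolding full_shift_def openin_product_topology_alt by blast
  define F where "F = {k. V k \<noteq> A}"
  have F: "finite F" using V(1) by (simp add: F_def)
  define N where "N = (\<Sum>k\<in>F. nat \<bar>k\<bar>)"
  have "y \<in> U" if y: "range y \<subseteq> A" "agree N x y" for y
  proof -
    have "y k \<in> V k" for k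
    proof (cases "k \<in> F")
      case True
      then have "nat \<bar>k\<bar> \<le> N" unfolding N_def using F by (intro member_le_sum) auto
      then have "y k = x k" using y by (simp add: agree_def)
      then show ?thesis using V(2) by (auto simp: PiE_def)
    next
      case False
      then show ?thesis using y by (auto simp: F_def)
    qed
    then show ?thesis using V(3) by (auto simp: PiE_def)
  qed
  then show ?thesis by (rule that)
qed

text \<open>
  Tychonoff's theorem in sequential form. If no point were a cluster point, each would have a
  cylinder that the sequence eventually avoids; finitely many of these cover the space.
\<close>

lemma cluster_point:
  assumes "finite A" and x: "\<And>i::nat. range (x i) \<subseteq> A"
  obtains y where "range y \<subseteq> A" "\<And>N r. \<exists>i\<ge>N. agree r (x i) y"
proof -
  have "\<exists>y. range y \<subseteq> A \<and> (\<forall>N r. \<exists>i\<ge>N. agree r (x i) y)"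
  proof (rule ccontr)
    assume not: "\<not> ?thesis"
    have "\<forall>y. \<exists>N r. range y \<subseteq> A \<longrightarrow> (\<forall>i\<ge>N. \<not> agree r (x i) y)"
      using not by blast
    then obtain N r where "\<forall>y. range y \<subseteq> A \<longrightarrow> (\<forall>i\<ge>N y. \<not> agree (r y) (x i) y)"
      unfolding choice_iff by blast
    then have Nr: "\<And>y i. range y \<subseteq> A \<Longrightarrow> i \<ge> N y \<Longrightarrow> \<not> agree (r y) (x i) y"
      by blast
    define C where "C = (\<lambda>y. {z. range z \<subseteq> A \<and> agree (r y) y z})"
    have "compact_space (full_shift A)"
      unfolding full_shift_def using assms(1) by (simp add: compact_space_product_topology compact_space_discrete_topology)
    moreover have "\<forall>U\<in>C ` topspace (full_shift A). openin (full_shift A) U"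
      unfolding C_def by (auto intro!: openin_cylinder)
    moreover have "topspace (full_shift A) \<subseteq> \<Union> (C ` topspace (full_shift A))"
      by (auto simp: C_def agree_def)
    ultimately obtain \<F> where \<F>: "finite \<F>" "\<F> \<subseteq> C ` topspace (full_shift A)" "topspace (full_shift A) \<subseteq> \<Union>\<F>"
      unfolding compact_space_alt by metis
    obtain Y where Y: "finite Y" "Y \<subseteq> topspace (full_shift A)" "\<F> = C ` Y"
      using \<F>(1,2) by (meson finite_subset_image)
    define i where "i = (\<Sum>y\<in>Y. N y)"
    have "x i \<in> topspace (full_shift A)" using x by simp
    then obtain y where y: "y \<in> Y" "x i \<in> C y" using \<F>(3) Y(3) by blast
    have "N y \<le> i" unfolding i_def using Y(1) y(1) by (intro member_le_sum) auto
    moreover have "range y \<subseteq> A" using y(1) Y(2) by auto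
    ultimately show False using Nr[of y i] y(2) agree_sym[of "r y" y "x i"] by (simp add: C_def)
  qed
  then show ?thesis using that by blast
qed

text \<open>
  Used to fix the letter and the position of a tower once and for all before a limit of points
  in the towers is taken.
\<close>

lemma antimono_pigeonhole:
  fixes Q :: "nat \<Rightarrow> 'p \<Rightarrow> bool"
  assumes "finite P" "\<And>r. \<exists>p\<in>P. Q r p" "\<And>r s p. Q s p \<Longrightarrow> r \<le> s \<Longrightarrow> Q r p"
  obtains p where "p \<in> P" "\<And>r. Q r p"
proof -
  have "\<exists>p\<in>P. \<forall>r. Q r p"
  proof (rule ccontr)
    assume "\<not> ?thesis"
    then obtain f where f: "\<And>p. p \<in> P \<Longrightarrow> \<not> Q (f p) p" by metis
    obtain p where p: "p \<in> P" "Q (\<Sum>p\<in>P. f p) p" using assms(2) by blast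
    then have "f p \<le> (\<Sum>p\<in>P. f p)" using assms(1) by (intro member_le_sum) auto
    then show False using f assms(3) p by blast
  qed
  then show ?thesis using that by blast
qed

section \<open>The circle\<close>

lemma int_dist_le: "int_dist x \<le> \<bar>x - of_int k\<bar>"
  unfolding int_dist_def by (rule round_diff_minimal)

lemma int_dist_nonneg [simp]: "0 \<le> int_dist x"
  by (simp add: int_dist_def)

lemma int_dist_le_abs: "int_dist x \<le> \<bar>x\<bar>"
  using int_dist_le[of x 0] by simp

lemma int_dist_eq_0_iff: "int_dist x = 0 \<longleftrightarrow> x \<in> \<int>"
  by (metis Ints_cases Ints_of_int abs_0_eq eq_iff_diff_eq_0 int_dist_def round_of_int)

lemma int_dist_minus [simp]: "int_dist (- x) = int_dist x"
  using int_dist_le[of x "- round (- x)"] int_dist_le[of "- x" "- round x"]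
  by (simp add: int_dist_def)

lemma int_dist_triangle: "int_dist (x + y) \<le> int_dist x + int_dist y"
  using int_dist_le[of "x + y" "round x + round y"] by (simp add: int_dist_def)

lemma int_dist_triangle_diff: "int_dist (x - y) \<le> int_dist x + int_dist y"
  using int_dist_triangle[of x "- y"] by simp

lemma int_dist_cong: "x - y \<in> \<int> \<Longrightarrow> int_dist x = int_dist y"
  using int_dist_triangle[of "x - y" y] int_dist_triangle[of "y - x" x]
    int_dist_eq_0_iff[of "x - y"] int_dist_eq_0_iff[of "y - x"] Ints_minus[of "x - y"]
  by simp

lemma int_dist_le_half: "int_dist x \<le> 1 / 2"
  unfolding int_dist_def using of_int_round_abs_le[of x] by (simp add: abs_minus_commute)

lemma circle_of_eq_iff: "circle_of r = circle_of s \<longleftrightarrow> r - s \<in> \<int>"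
  by transfer simp

lemma circle_of_add: "circle_of (r + s) = circle_of r + circle_of s"
  by transfer simp

lemma circle_of_diff: "circle_of (r - s) = circle_of r - circle_of s"
  by transfer simp

lemma circle_of_0: "circle_of 0 = 0"
  by transfer simp

lemma circle_of_surj: "\<exists>r. c = circle_of r"
  by transfer (metis Ints_0 cancel_comm_monoid_add_class.diff_cancel)

text \<open>
  A representative in \<open>[-1/2, 1/2]\<close>. Its absolute value is the quotient norm on the circle
  (\<open>abs_centered_lift\<close>), and so it also serves as the metric.
\<close>

definition centered_lift :: "circle \<Rightarrow> real" where
  "centered_lift c = (let r = (SOME r. circle_of r = c) in r - of_int (round r))"

lemma circle_of_centered_lift [simp]: "circle_of (centered_lift c) = c"
proof -
  have "circle_of (SOME r. circle_of r = c) = c"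
    using circle_of_surj[of c] by (metis (mono_tags) someI)
  moreover have "circle_of (r - of_int k) = circle_of r" for r k
    by (simp add: circle_of_eq_iff)
  ultimately show ?thesis by (simp add: centered_lift_def Let_def)
qed

lemma abs_centered_lift: "\<bar>centered_lift (circle_of r)\<bar> = int_dist r"
proof -
  define s where "s = (SOME s. circle_of s = circle_of r)"
  have "circle_of s = circle_of r" unfolding s_def by (rule someI) (rule refl)
  then have "int_dist s = int_dist r" by (simp add: circle_of_eq_iff int_dist_cong)
  moreover have "\<bar>centered_lift (circle_of r)\<bar> = int_dist s"
    by (simp add: centered_lift_def Let_def int_dist_def s_def)
  ultimately show ?thesis by simp
qed

lemma circle_of_inject_small:
  assumes "circle_of r = circle_of s" "\<bar>r - s\<bar> < 1"
  shows "r = s"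
proof -
  obtain k where "r - s = of_int k" using assms(1) by (auto simp: circle_of_eq_iff elim: Ints_cases)
  then show ?thesis using assms(2) by (simp del: of_int_abs add: of_int_abs[symmetric])
qed

lemma abs_centered_lift_add: "\<bar>centered_lift (c + d)\<bar> \<le> \<bar>centered_lift c\<bar> + \<bar>centered_lift d\<bar>"
  using int_dist_triangle[of "centered_lift c" "centered_lift d"]
    abs_centered_lift[of "centered_lift c + centered_lift d"]
    abs_centered_lift[of "centered_lift c"] abs_centered_lift[of "centered_lift d"]
  by (simp add: circle_of_add)

lemma abs_centered_lift_diff_commute: "\<bar>centered_lift (c - d)\<bar> = \<bar>centered_lift (d - c)\<bar>"
  using abs_centered_lift[of "centered_lift c - centered_lift d"]
    abs_centered_lift[of "centered_lift d - centered_lift c"]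
    int_dist_minus[of "centered_lift c - centered_lift d"]
  by (simp add: circle_of_diff)

lemma abs_centered_lift_le_half: "\<bar>centered_lift c\<bar> \<le> 1 / 2"
  using abs_centered_lift[of "centered_lift c"] int_dist_le_half[of "centered_lift c"] by simp

lemma open_circle_ball: "open {c. \<bar>centered_lift (c - c0)\<bar> < e}"
proof -
  obtain r0 where r0: "c0 = circle_of r0" using circle_of_surj by blast
  have "open {r. int_dist (r - r0) < e}"
  proof (rule openI)
    fix r assume r: "r \<in> {r. int_dist (r - r0) < e}"
    have "s \<in> {r. int_dist (r - r0) < e}" if "s \<in> ball r (e - int_dist (r - r0))" for s
      using that int_dist_triangle[of "r - r0" "s - r"] int_dist_le_abs[of "s - r"]
      by (auto simp: dist_real_def)
    then show "\<exists>d>0. ball r d \<subseteq> {r. int_dist (r - r0) < e}" using r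
      by (intro exI[of _ "e - int_dist (r - r0)"]) auto
  qed
  moreover have "circle_of -` {c. \<bar>centered_lift (c - c0)\<bar> < e} = {r. int_dist (r - r0) < e}"
    by (auto simp: r0 abs_centered_lift circle_of_diff[symmetric])
  ultimately show ?thesis by (simp add: open_circle_def)
qed

lemma open_circle_contains_ball:
  assumes "open U" "c \<in> U"
  obtains e where "e > 0" "\<And>d. \<bar>centered_lift (d - c)\<bar> < e \<Longrightarrow> d \<in> U"
proof -
  obtain r where r: "c = circle_of r" using circle_of_surj by blast
  have "open (circle_of -` U)" using assms(1) by (simp add: open_circle_def)
  then obtain e where e: "e > 0" "ball r e \<subseteq> circle_of -` U"
    using assms(2) r openE[of "circle_of -` U" r] by auto
  have "d \<in> U" if "\<bar>centered_lift (d - c)\<bar> < e" for d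
  proof -
    have "r + centered_lift (d - c) \<in> ball r e" using that by (simp add: dist_real_def)
    then have "r + centered_lift (d - c) \<in> circle_of -` U" using e(2) by blast
    then show ?thesis by (simp add: circle_of_add r[symmetric])
  qed
  then show ?thesis using that e(1) by blast
qed

text \<open>
  Both topologies have explicit neighbourhood bases, cylinders and arcs; from here on continuity is
  used only in this form.
\<close>

lemma continuous_map_circle_iff:
  fixes g :: "(int \<Rightarrow> 'a) \<Rightarrow> circle"
  assumes X: "\<And>x. x \<in> X \<Longrightarrow> range x \<subseteq> A"
  shows "continuous_map (subtopology (full_shift A) X) euclidean g \<longleftrightarrow>
    (\<forall>x\<in>X. \<forall>e>0. \<exists>N. \<forall>y\<in>X. agree N x y \<longrightarrow> \<bar>centered_lift (g y - g x)\<bar> < e)" (is "?L \<longleftrightarrow> ?R")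
proof
  assume L: ?L
  show ?R
  proof (intro ballI allI impI)
    fix x and e :: real assume x: "x \<in> X" and e: "e > 0"
    define U where "U = {y \<in> topspace (subtopology (full_shift A) X). g y \<in> {c. \<bar>centered_lift (c - g x)\<bar> < e}}"
    have "openin (subtopology (full_shift A) X) U"
      using L unfolding U_def continuous_map_def by (auto intro: open_circle_ball)
    then obtain V where V: "openin (full_shift A) V" "U = V \<inter> X" by (auto simp: openin_subtopology)
    have "centered_lift 0 = 0" using abs_centered_lift[of 0] by (simp add: circle_of_0 int_dist_def)
    then have "x \<in> U" using x X e by (auto simp: U_def)
    then obtain N where N: "\<And>y. range y \<subseteq> A \<Longrightarrow> agree N x y \<Longrightarrow> y \<in> V"
      using openin_full_shift_cylinder[OF V(1)] V(2) by blast
    then have "\<forall>y\<in>X. agree N x y \<longrightarrow> \<bar>centered_lift (g y - g x)\<bar> < e"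
      using V(2) X by (auto simp: U_def)
    then show "\<exists>N. \<forall>y\<in>X. agree N x y \<longrightarrow> \<bar>centered_lift (g y - g x)\<bar> < e" ..
  qed
next
  assume R: ?R
  show ?L unfolding continuous_map_def
  proof (intro conjI allI impI)
    fix U :: "circle set" assume "openin euclidean U"
    then have U: "open U" by simp
    show "openin (subtopology (full_shift A) X) {x \<in> topspace (subtopology (full_shift A) X). g x \<in> U}"
    proof (subst openin_subopen, intro ballI)
      fix x assume "x \<in> {x \<in> topspace (subtopology (full_shift A) X). g x \<in> U}"
      then have x: "x \<in> X" "g x \<in> U" "range x \<subseteq> A" by auto
      obtain e where e: "e > 0" "\<And>d. \<bar>centered_lift (d - g x)\<bar> < e \<Longrightarrow> d \<in> U"
        using open_circle_contains_ball[OF U x(2)] by metis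
      obtain N where N: "\<And>y. y \<in> X \<Longrightarrow> agree N x y \<Longrightarrow> \<bar>centered_lift (g y - g x)\<bar> < e"
        using R x(1) e(1) by blast
      have "openin (subtopology (full_shift A) X) ({y. range y \<subseteq> A \<and> agree N x y} \<inter> X)"
        using openin_cylinder[OF x(3)] by (auto simp: openin_subtopology)
      moreover have "x \<in> {y. range y \<subseteq> A \<and> agree N x y} \<inter> X" using x by (auto simp: agree_def)
      moreover have "{y. range y \<subseteq> A \<and> agree N x y} \<inter> X
          \<subseteq> {x \<in> topspace (subtopology (full_shift A) X). g x \<in> U}"
        using e(2) N by auto
      ultimately show "\<exists>T. openin (subtopology (full_shift A) X) T \<and> x \<in> T
          \<and> T \<subseteq> {x \<in> topspace (subtopology (full_shift A) X). g x \<in> U}" by blast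
    qed
  qed auto
qed

section \<open>The languages and subshifts of the levels\<close>

lemma sublist_word: "l' \<le> l \<Longrightarrow> l + int k \<le> l' + int k' \<Longrightarrow> sublist (word x l k) (word x l' k')"
proof -
  assume a: "l' \<le> l" "l + int k \<le> l' + int k'"
  then have "k' = nat (l - l') + k + nat (l' + int k' - l - int k)" by linarith
  then have "word x l' k' = word x l' (nat (l - l')) @ word x l k @ word x (l + int k) (nat (l' + int k' - l - int k))"
    using a word_add[of x l' "nat (l - l')" "k + nat (l' + int k' - l - int k)"]
      word_add[of x l k "nat (l' + int k' - l - int k)"] by (simp add: add.assoc)
  then show ?thesis by (metis sublist_appendI)
qed

lemma word_cong: "(\<And>k. l \<le> k \<Longrightarrow> k < l + int n \<Longrightarrow> x k = y k) \<Longrightarrow> word x l n = word y l n"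
  by (simp add: word_def)

lemma word_extension:
  assumes "W \<in> lists A" "i < length W"
  obtains y where "range y \<subseteq> A" "word y (- int i) (length W) = W"
proof
  \<comment> \<open>Outside the window covered by \<open>W\<close> any letter would do.\<close>
  define y where "y = (\<lambda>k. if 0 \<le> int i + k \<and> int i + k < int (length W) then W ! nat (int i + k) else W ! i)"
  show "range y \<subseteq> A" using assms by (auto simp: y_def in_lists_conv_set)
  show "word y (- int i) (length W) = W"
    by (rule nth_equalityI) (auto simp: y_def)
qed

lemma foldr_comp_id: "foldr (\<lambda>i f. \<tau> i \<circ> f) is g = foldr (\<lambda>i f. \<tau> i \<circ> f) is id \<circ> g"
  by (induction "is") (auto simp: comp_assoc)

lemma subst_comp_same [simp]: "subst_comp \<tau> n n = id"
  by (simp add: subst_comp_def)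

lemma subst_comp_split:
  assumes "n \<le> m" "m \<le> k"
  shows "subst_comp \<tau> n k = subst_comp \<tau> n m \<circ> subst_comp \<tau> m k"
proof -
  have "[n..<k] = [n..<m] @ [m..<k]" using assms upt_add_eq_append[of n m "k - m"] by simp
  then show ?thesis using foldr_comp_id[of \<tau> "[n..<m]" "subst_comp \<tau> m k"]
    by (simp add: subst_comp_def)
qed

lemma subst_comp_single: "subst_comp \<tau> n (Suc n) = \<tau> n"
  by (simp add: subst_comp_def)

lemma subst_comp_Suc: "n \<le> m \<Longrightarrow> subst_comp \<tau> n (Suc m) = subst_comp \<tau> n m \<circ> \<tau> m"
  using subst_comp_split[of n m "Suc m" \<tau>] by (simp add: subst_comp_single)

lemma height_Suc: "height \<tau> (Suc n) u = height \<tau> n (\<tau> n u)"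
  by (simp add: height_def subst_comp_Suc)

locale positive_directive_sequence =
  fixes A :: "nat \<Rightarrow> 'a set" and \<tau> :: "nat \<Rightarrow> 'a list \<Rightarrow> 'a list"
  assumes directive: "directive_sequence A \<tau>" and positive: "positive_seq A \<tau>"
begin

lemma finite_alphabet: "finite (A n)"
  using directive by (simp add: directive_sequence_def alphabet_def)

lemma card_alphabet: "card (A n) \<ge> 2"
  using directive by (simp add: directive_sequence_def alphabet_def)

lemma alphabet_nonempty: "A n \<noteq> {}"
  using card_alphabet[of n] by auto

lemma substitution_\<tau>: "substitution (A (Suc n)) (A n) (\<tau> n)"
  using directive by (simp add: directive_sequence_def)

lemma substitution_subst_comp: "n \<le> m \<Longrightarrow> substitution (A m) (A n) (subst_comp \<tau> n m)"
proof (induction m rule: dec_induct)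
  case base
  then show ?case using substitution_id[of "A n"] by (simp only: subst_comp_same)
next
  case (step m)
  then show ?case using substitution_comp[OF step.IH substitution_\<tau>] by (simp only: subst_comp_Suc)
qed

abbreviation \<sigma> :: "nat \<Rightarrow> 'a list \<Rightarrow> 'a list" where
  "\<sigma> n \<equiv> subst_comp \<tau> 0 n"

lemma substitution_\<sigma>: "substitution (A n) (A 0) (\<sigma> n)"
  by (simp add: substitution_subst_comp)

lemma height_append: "u \<in> lists (A n) \<Longrightarrow> v \<in> lists (A n) \<Longrightarrow> height \<tau> n (u @ v) = height \<tau> n u + height \<tau> n v"
  by (simp add: height_def substitution_append[OF substitution_\<sigma>])

lemma \<tau>_lists: "u \<in> lists (A (Suc n)) \<Longrightarrow> \<tau> n u \<in> lists (A n)"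
  by (rule substitution_lists[OF substitution_\<tau>])

lemma \<tau>_letter_lists: "b \<in> A (Suc n) \<Longrightarrow> \<tau> n [b] \<in> lists (A n)"
  by (rule \<tau>_lists) auto

lemma \<tau>_positive: "a \<in> A n \<Longrightarrow> b \<in> A (Suc n) \<Longrightarrow> a \<in> set (\<tau> n [b])"
  using positive by (simp add: positive_seq_def)

lemma length_\<tau>_letter: "b \<in> A (Suc n) \<Longrightarrow> length (\<tau> n [b]) \<ge> 2"
proof -
  assume "b \<in> A (Suc n)"
  then have "A n \<subseteq> set (\<tau> n [b])" using \<tau>_positive by auto
  then have "card (A n) \<le> card (set (\<tau> n [b]))" by (intro card_mono) auto
  also have "\<dots> \<le> length (\<tau> n [b])" by (rule card_length)
  finally show ?thesis using card_alphabet[of n] by simp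
qed

text \<open>
  Positivity and alphabets with two letters make every image of a letter longer than one, so lengths
  grow with the number of levels. A linear bound suffices below.
\<close>

lemma length_subst_comp_letter: "n \<le> m \<Longrightarrow> b \<in> A m \<Longrightarrow> length (subst_comp \<tau> n m [b]) > m - n"
proof (induction m arbitrary: b rule: dec_induct)
  case (step m)
  define u where "u = \<tau> m [b]"
  have u: "u \<in> lists (A m)" "length u \<ge> 2"
    using step.prems length_\<tau>_letter \<tau>_letter_lists by (auto simp: u_def)
  then obtain a v where v: "u = a # v" "length v \<ge> 1" by (cases u) auto
  have s: "substitution (A m) (A n) (subst_comp \<tau> n m)" using step.hyps by (simp add: substitution_subst_comp)
  have "length (subst_comp \<tau> n m u) = length (subst_comp \<tau> n m [a]) + length (subst_comp \<tau> n m v)"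
    using u v substitution_Cons[OF s, of a v] by simp
  moreover have "length v \<le> length (subst_comp \<tau> n m v)"
    using u v by (intro substitution_length_ge[OF s]) auto
  moreover have "length (subst_comp \<tau> n m [a]) > m - n" using step.IH[of a] u v by simp
  ultimately show ?case using v(2) step.hyps by (simp add: subst_comp_Suc u_def)
qed simp

lemma height_letter: "b \<in> A n \<Longrightarrow> height \<tau> n [b] > n"
  using length_subst_comp_letter[of 0 n b] by (simp add: height_def)

lemma subst_comp_positive: "n < m \<Longrightarrow> a \<in> A n \<Longrightarrow> b \<in> A m \<Longrightarrow> a \<in> set (subst_comp \<tau> n m [b])"
proof (induction m arbitrary: b)
  case 0
  then show ?case by simp
next
  case (Suc m)
  show ?case
  proof (cases "n = m")
    case True
    then show ?thesis using Suc.prems \<tau>_positive by (simp add: subst_comp_single)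
  next
    case False
    then have nm: "n < m" using Suc.prems by simp
    obtain c where c: "c \<in> A m" using alphabet_nonempty by blast
    then have "c \<in> set (\<tau> m [b])" using Suc.prems \<tau>_positive by simp
    then have "sublist [c] (\<tau> m [b])" by (metis append_Cons append_Nil split_list sublist_appendI)
    then have "sublist (subst_comp \<tau> n m [c]) (subst_comp \<tau> n m (\<tau> m [b]))"
      using nm Suc.prems \<tau>_letter_lists
      by (intro substitution_sublist[OF substitution_subst_comp]) auto
    then show ?thesis
      using Suc.IH[OF nm Suc.prems(2) c] nm set_mono_sublist by (fastforce simp: subst_comp_Suc)
  qed
qed

definition language :: "nat \<Rightarrow> 'a list set" where
  "language n = {w. \<exists>m>n. \<exists>a\<in>A m. sublist w (subst_comp \<tau> n m [a])}"

lemma language_sublist: "w \<in> language n \<Longrightarrow> sublist v w \<Longrightarrow> v \<in> language n"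
  unfolding language_def using sublist_order.order.trans by blast

text \<open>By positivity a factor seen at one level is seen at all later ones.\<close>

lemma language_late:
  assumes "w \<in> language n"
  obtains m c where "m > n" "m > M" "c \<in> A m" "sublist w (subst_comp \<tau> n m [c])"
proof -
  obtain m a where m: "m > n" "a \<in> A m" "sublist w (subst_comp \<tau> n m [a])"
    using assms by (auto simp: language_def)
  define k where "k = Suc (m + M)"
  obtain c where c: "c \<in> A k" using alphabet_nonempty by blast
  have "a \<in> set (subst_comp \<tau> m k [c])" using m c by (intro subst_comp_positive) (auto simp: k_def)
  then have "sublist [a] (subst_comp \<tau> m k [c])"
    by (metis append_Cons append_Nil split_list sublist_appendI)
  then have "sublist (subst_comp \<tau> n m [a]) (subst_comp \<tau> n m (subst_comp \<tau> m k [c]))"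
    using m(1) c substitution_lists[OF substitution_subst_comp[of m k], of "[c]"]
    by (intro substitution_sublist[OF substitution_subst_comp]) (auto simp: k_def)
  then have "sublist w (subst_comp \<tau> n k [c])"
    using m sublist_order.order.trans subst_comp_split[of n m k \<tau>] by (fastforce simp: k_def)
  then show ?thesis using that[of k c] c m(1) by (auto simp: k_def)
qed

lemma language_subst_comp:
  assumes "n \<le> m" "w \<in> language m"
  shows "subst_comp \<tau> n m w \<in> language n"
proof -
  obtain k a where k: "k > m" "a \<in> A k" "sublist w (subst_comp \<tau> m k [a])"
    using assms(2) by (auto simp: language_def)
  have "sublist (subst_comp \<tau> n m w) (subst_comp \<tau> n m (subst_comp \<tau> m k [a]))"
    using assms(1) k substitution_lists[OF substitution_subst_comp[of m k], of "[a]"]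
    by (intro substitution_sublist[OF substitution_subst_comp]) auto
  then show ?thesis using assms(1) k subst_comp_split[of n m k \<tau>]
    by (auto simp: language_def intro!: exI[of _ k] bexI[of _ a])
qed

lemma level_shift_iff:
  "x \<in> level_shift A \<tau> n \<longleftrightarrow> range x \<subseteq> A n \<and> (\<forall>l k. word x l k \<in> language n)"
proof -
  have "(\<forall>i j. map x [i..j] \<in> language n) \<longleftrightarrow> (\<forall>l k. word x l k \<in> language n)"
  proof (intro iffI allI)
    fix l k assume "\<forall>i j. map x [i..j] \<in> language n"
    then have "map x [l..l + int k - 1] \<in> language n" by blast
    then show "word x l k \<in> language n" by (simp add: map_upto_eq_word)
  qed (simp add: map_upto_eq_word)
  then show ?thesis by (auto simp: level_shift_def language_def)
qed

lemma level_shift_range: "x \<in> level_shift A \<tau> n \<Longrightarrow> range x \<subseteq> A n"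
  by (simp add: level_shift_iff)

lemma level_shift_funpow_shift:
  "x \<in> level_shift A \<tau> n \<Longrightarrow> (shift ^^ i) x \<in> level_shift A \<tau> n"
proof -
  assume x: "x \<in> level_shift A \<tau> n"
  have "word ((shift ^^ i) x) l k = word x (l + int i) k" for l k
    by (simp add: word_def funpow_shift algebra_simps)
  then show ?thesis using x by (auto simp: level_shift_iff funpow_shift)
qed

lemma level_shift_subst_seq:
  assumes "n \<le> m" and y: "y \<in> level_shift A \<tau> m"
  shows "subst_seq (subst_comp \<tau> n m) y \<in> level_shift A \<tau> n"
proof -
  define \<rho> where "\<rho> = subst_comp \<tau> n m"
  have s: "substitution (A m) (A n) \<rho>" using assms(1) by (simp add: \<rho>_def substitution_subst_comp)
  have r: "range y \<subseteq> A m" using y by (rule level_shift_range)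
  have "word (subst_seq \<rho> y) l k \<in> language n" for l k
  proof -
    define K where "K = nat \<bar>l\<bar> + k"
    define u where "u = word y (- int K) (2 * K)"
    have "start \<rho> y (- int K + int (2 * K)) = start \<rho> y (- int K) + int (length (\<rho> u))"
      unfolding u_def by (rule start_add[OF s r])
    then have "sublist (word (subst_seq \<rho> y) l k) (word (subst_seq \<rho> y) (start \<rho> y (- int K)) (length (\<rho> u)))"
      using start_ge[OF s r, of "int K"] by (intro sublist_word) (auto simp: K_def)
    then have "sublist (word (subst_seq \<rho> y) l k) (\<rho> u)"
      by (simp add: u_def word_subst_seq[OF s r])
    moreover have "u \<in> language m" using y by (simp add: level_shift_iff u_def)
    ultimately show ?thesis
      using language_subst_comp[OF assms(1)] language_sublist unfolding \<rho>_def by blast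
  qed
  then show ?thesis using range_subst_seq[OF s r] by (simp add: level_shift_iff \<rho>_def)
qed

text \<open>
  Membership in a level shift is a condition on finite windows. Hence only the central windows of the
  approximating sequences have to lie in the language; the sequences themselves are arbitrary outside.
\<close>

lemma level_shift_limit:
  assumes "\<And>r. range (y r) \<subseteq> A n" "\<And>r. word (y r) (- int r) (2 * r + 1) \<in> language n"
  obtains z where "z \<in> level_shift A \<tau> n" "\<And>r. \<exists>R\<ge>r. agree r (y R) z"
proof -
  obtain z where z: "range z \<subseteq> A n" "\<And>N r. \<exists>i\<ge>N. agree r (y i) z"
    using cluster_point[OF finite_alphabet[of n], of y] assms(1) by metis
  have "word z l k \<in> language n" for l k
  proof -
    define r where "r = nat \<bar>l\<bar> + k"
    obtain R where R: "R \<ge> r" "agree r (y R) z" using z(2) by blast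
    have "word z l k = word (y R) l k"
      using R(2) by (intro word_cong) (auto simp: agree_def r_def)
    moreover have "sublist (word (y R) l k) (word (y R) (- int R) (2 * R + 1))"
      using R(1) by (intro sublist_word) (auto simp: r_def)
    ultimately show ?thesis using assms(2)[of R] language_sublist by metis
  qed
  then have "z \<in> level_shift A \<tau> n" using z(1) by (simp add: level_shift_iff)
  then show ?thesis using that z(2) by blast
qed

lemma level_shift_nonempty: "level_shift A \<tau> n \<noteq> {}"
proof -
  have "\<exists>y. range y \<subseteq> A n \<and> word y (- int r) (2 * r + 1) \<in> language n" for r
  proof -
    define m where "m = n + (2 * r + 1)"
    obtain c where c: "c \<in> A m" using alphabet_nonempty by blast
    define W where "W = subst_comp \<tau> n m [c]"
    have W: "length W > 2 * r + 1" using length_subst_comp_letter[of n m c] c by (simp add: W_def m_def)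
    have "W \<in> lists (A n)"
      using c substitution_lists[OF substitution_subst_comp[of n m], of "[c]"] by (simp add: W_def m_def)
    then obtain y where y: "range y \<subseteq> A n" "word y (- int r) (length W) = W"
      using word_extension[of W "A n" r] W by auto
    have "sublist (word y (- int r) (2 * r + 1)) (word y (- int r) (length W))"
      using W by (intro sublist_word) auto
    then have "word y (- int r) (2 * r + 1) \<in> language n"
      using y(2) c by (auto simp: language_def W_def m_def intro!: exI[of _ m])
    then show ?thesis using y(1) by blast
  qed
  then obtain y where "\<And>r. range (y r) \<subseteq> A n" "\<And>r. word (y r) (- int r) (2 * r + 1) \<in> language n"
    by metis
  then obtain z where "z \<in> level_shift A \<tau> n" by (rule level_shift_limit)
  then show ?thesis by blast
qed

text \<open>
  One level up there is some point; by positivity the image of its letter at the origin contains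
  \<open>a\<close>, and a shift brings that occurrence to the origin.
\<close>

lemma level_shift_letter:
  assumes a: "a \<in> A n"
  obtains y where "y \<in> level_shift A \<tau> n" "y 0 = a"
proof -
  obtain z where z: "z \<in> level_shift A \<tau> (Suc n)" using level_shift_nonempty by blast
  have r: "range z \<subseteq> A (Suc n)" using z by (rule level_shift_range)
  define y where "y = subst_seq (\<tau> n) z"
  have y: "y \<in> level_shift A \<tau> n"
    using level_shift_subst_seq[of n "Suc n" z] z by (simp add: y_def subst_comp_single)
  have "z 0 \<in> A (Suc n)" using r by auto
  then obtain i where i: "i < length (\<tau> n [z 0])" "\<tau> n [z 0] ! i = a"
    using \<tau>_positive[OF a] by (metis in_set_conv_nth)
  then have "(shift ^^ i) y 0 = a"
    using subst_seq_letter[OF substitution_\<tau> r, of i 0] start_0[OF substitution_\<tau>, of n z]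
    by (simp add: y_def funpow_shift)
  then show ?thesis using that level_shift_funpow_shift[OF y] by blast
qed

section \<open>Towers\<close>

definition in_tower :: "nat \<Rightarrow> (int \<Rightarrow> 'a) \<Rightarrow> 'a \<Rightarrow> nat \<Rightarrow> bool" where
  "in_tower n x a p \<longleftrightarrow> a \<in> A n \<and> p < height \<tau> n [a] \<and> x \<in> (shift ^^ p) ` tower_base A \<tau> n a"

lemma tower_base_nonempty: "a \<in> A n \<Longrightarrow> tower_base A \<tau> n a \<noteq> {}"
  using level_shift_letter[of a n] unfolding tower_base_def by blast

lemma tower_base_subset: "tower_base A \<tau> n a \<subseteq> level_shift A \<tau> 0"
  using level_shift_subst_seq[of 0 n] by (auto simp: tower_base_def)

text \<open>
  Since \<open>\<sigma> (n + 1) = \<sigma> n \<circ> \<tau> n\<close>, a point of the base is \<open>\<sigma> n\<close> of a sequence that reads \<open>\<tau> n [b]\<close> from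
  the origin on; moving that sequence by \<open>i\<close> letters moves the point by the height of these letters.
\<close>

lemma tower_base_descend:
  assumes w: "w \<in> tower_base A \<tau> (Suc n) b" and i: "i < length (\<tau> n [b])"
  shows "(shift ^^ height \<tau> n (take i (\<tau> n [b]))) w \<in> tower_base A \<tau> n (\<tau> n [b] ! i)"
proof -
  obtain y where y: "y \<in> level_shift A \<tau> (Suc n)" "y 0 = b" "w = subst_seq (\<sigma> (Suc n)) y"
    using w by (auto simp: tower_base_def)
  have r: "range y \<subseteq> A (Suc n)" using y(1) by (rule level_shift_range)
  define z where "z = subst_seq (\<tau> n) y"
  have z: "z \<in> level_shift A \<tau> n"
    using level_shift_subst_seq[of n "Suc n" y] y by (simp add: z_def subst_comp_single)
  have w': "w = subst_seq (\<sigma> n) z"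
    using y(3) subst_seq_comp[OF substitution_\<sigma> substitution_\<tau> r] by (simp add: z_def subst_comp_Suc)
  have wd: "word z 0 (length (\<tau> n [b])) = \<tau> n [b]"
    using word_subst_seq[OF substitution_\<tau> r, of 0 1] y(2) start_0[OF substitution_\<tau>, of n y]
    by (simp add: word_1 z_def)
  then have "word z 0 i = take i (\<tau> n [b])" using i by (metis less_imp_le take_word)
  then have "(shift ^^ height \<tau> n (take i (\<tau> n [b]))) w = subst_seq (\<sigma> n) ((shift ^^ i) z)"
    using subst_seq_funpow_shift[OF substitution_\<sigma> level_shift_range[OF z], of i]
    by (simp add: w' height_def)
  moreover have "(shift ^^ i) z 0 = \<tau> n [b] ! i"
    using wd i by (metis add_0 funpow_shift nth_word)
  ultimately show ?thesis using level_shift_funpow_shift[OF z] by (auto simp: tower_base_def)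
qed

lemma in_tower_descend:
  assumes x: "in_tower (Suc n) x b q"
  obtains i p where "i < length (\<tau> n [b])" "q = height \<tau> n (take i (\<tau> n [b])) + p" "in_tower n x (\<tau> n [b] ! i) p"
proof -
  obtain w where b: "b \<in> A (Suc n)" and q: "q < height \<tau> (Suc n) [b]"
    and w: "w \<in> tower_base A \<tau> (Suc n) b" "x = (shift ^^ q) w"
    using x by (auto simp: in_tower_def)
  define V where "V = \<tau> n [b]"
  have V: "V \<in> lists (A n)" using b by (simp add: V_def \<tau>_letter_lists)
  have "q < length (\<sigma> n V)" using q unfolding height_Suc V_def by (simp add: height_def)
  then obtain i p where ip: "i < length V" "p < length (\<sigma> n [V ! i])" "q = length (\<sigma> n (take i V)) + p"
    by (rule substitution_position[OF substitution_\<sigma> V])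
  have "x = (shift ^^ p) ((shift ^^ height \<tau> n (take i V)) w)"
    by (simp add: w(2) ip(3) height_def funpow_add add.commute)
  then have "in_tower n x (V ! i) p"
    using tower_base_descend[OF w(1), of i] ip V by (auto simp: in_tower_def height_def V_def in_lists_conv_set)
  then show ?thesis using that ip by (simp add: V_def height_def)
qed

text \<open>
  The common limit argument for the existence of positions and for the closedness of towers: the
  approximating \<open>y\<close> have a cluster point in the level shift, and by \<open>subst_seq_cong\<close> its image inherits
  the agreement with \<open>x\<close> on every window.
\<close>

lemma in_tower_limit:
  assumes p: "p < height \<tau> n [a]" "a \<in> A n"
    and ex: "\<And>r. \<exists>y. range y \<subseteq> A n \<and> word y (- int r) (2 * r + 1) \<in> language n \<and> y 0 = a \<and>
      agree r ((shift ^^ p) (subst_seq (\<sigma> n) y)) x"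
  shows "in_tower n x a p"
proof -
  obtain y where y: "\<And>r. range (y r) \<subseteq> A n" "\<And>r. word (y r) (- int r) (2 * r + 1) \<in> language n"
    "\<And>r. y r 0 = a" "\<And>r. agree r ((shift ^^ p) (subst_seq (\<sigma> n) (y r))) x"
    using ex by metis
  obtain z where z: "z \<in> level_shift A \<tau> n" "\<And>r. \<exists>R\<ge>r. agree r (y R) z"
    using level_shift_limit[of y n] y(1,2) by metis
  have "z 0 = a" using z(2)[of 0] y(3) by (auto simp: agree_def)
  moreover have "(shift ^^ p) (subst_seq (\<sigma> n) z) = x"
  proof
    fix j
    define r where "r = nat \<bar>j\<bar> + p"
    obtain R where R: "R \<ge> r" "agree r (y R) z" using z(2) by blast
    have "subst_seq (\<sigma> n) (y R) (j + int p) = subst_seq (\<sigma> n) z (j + int p)"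
      using R(2) by (intro subst_seq_cong) (auto simp: agree_def r_def)
    then show "(shift ^^ p) (subst_seq (\<sigma> n) z) j = x j"
      using y(4)[of R] R(1) by (auto simp: agree_def r_def funpow_shift)
  qed
  ultimately show ?thesis using z(1) p by (auto simp: in_tower_def tower_base_def)
qed

lemma finite_tower_positions: "finite (SIGMA a:A n. {..<height \<tau> n [a]})"
  by (intro finite_SigmaI finite_alphabet) auto

text \<open>
  A long central window of \<open>x\<close> occurs in \<open>\<sigma> m [c] = \<sigma> n W\<close> with \<open>W = subst_comp \<tau> n m [c]\<close> and \<open>m > n\<close>.
  Desubstituting the position of the origin gives a letter of \<open>W\<close>, far from both ends of \<open>W\<close> because
  images of letters under \<open>\<sigma> n\<close> have bounded length, and an offset \<open>p\<close>. Letters and offsets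
  range over a finite set, so one pair serves arbitrarily long windows.
\<close>

lemma in_tower_exists:
  assumes x: "x \<in> level_shift A \<tau> 0"
  obtains a p where "in_tower n x a p"
proof -
  define Q where "Q = (\<lambda>r ap. \<exists>y. range y \<subseteq> A n \<and> word y (- int r) (2 * r + 1) \<in> language n \<and> y 0 = fst ap \<and>
      agree r ((shift ^^ snd ap) (subst_seq (\<sigma> n) y)) x)"
  have "\<exists>ap\<in>(SIGMA a:A n. {..<height \<tau> n [a]}). Q r ap" for r
  proof -
    define H where "H = Suc (Max ((\<lambda>a. height \<tau> n [a]) ` A n))"
    have H: "length (\<sigma> n [a]) \<le> H" if "a \<in> A n" for a
      using that finite_alphabet[of n] unfolding H_def height_def by (simp add: le_SucI)
    \<comment> \<open>Each letter of \<open>W\<close> covers at most \<open>H\<close> coordinates, so a radius of \<open>(r + 1) * H\<close> leaves at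
      least \<open>r\<close> letters of \<open>W\<close> on each side of the one over the origin.\<close>
    define K where "K = (r + 1) * H"
    have "word x (- int K) (2 * K + 1) \<in> language 0" using x by (simp add: level_shift_iff)
    then obtain m c where m: "m > n" "c \<in> A m" "sublist (word x (- int K) (2 * K + 1)) (\<sigma> m [c])"
      by (rule language_late[where M = n])
    define W where "W = subst_comp \<tau> n m [c]"
    have W: "W \<in> lists (A n)"
      using m(1,2) substitution_lists[OF substitution_subst_comp[of n m], of "[c]"] by (simp add: W_def)
    have "\<sigma> m [c] = \<sigma> n W" using subst_comp_split[of 0 n m \<tau>] m(1) by (simp add: W_def)
    then obtain P S where PS: "\<sigma> n W = P @ word x (- int K) (2 * K + 1) @ S"
      using m(3) by (auto simp: sublist_def)
    define q where "q = length P + K"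
    have "q < length (\<sigma> n W)" by (simp add: PS q_def)
    then obtain i p where ip: "i < length W" "p < length (\<sigma> n [W ! i])" "q = length (\<sigma> n (take i W)) + p"
      by (rule substitution_position[OF substitution_\<sigma> W])
    have tk: "take i W \<in> lists (A n)" "drop i W \<in> lists (A n)"
      using W by (auto simp: in_lists_conv_set dest: in_set_takeD in_set_dropD)
    have Wi: "W ! i \<in> A n" using ip W by (auto simp: in_lists_conv_set)
    have l1: "length (\<sigma> n (take i W)) \<le> i * H"
      using substitution_length_le[OF substitution_\<sigma> tk(1) H] ip(1) by simp
    have "\<sigma> n W = \<sigma> n (take i W) @ \<sigma> n (drop i W)"
      using substitution_append[OF substitution_\<sigma> tk] by simp
    then have l2: "length (\<sigma> n W) \<le> length (\<sigma> n (take i W)) + (length W - i) * H"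
      using substitution_length_le[OF substitution_\<sigma> tk(2) H] by simp
    have "(r + 1) * H < (i + 1) * H + 1"
    proof -
      have "(r + 1) * H \<le> q" by (simp add: q_def K_def)
      also have "\<dots> < i * H + H + 1" using l1 ip(2,3) H[OF Wi] by linarith
      finally show ?thesis by (simp add: algebra_simps)
    qed
    then have "(r + 1) * H \<le> (i + 1) * H" by linarith
    then have "r + 1 \<le> i + 1" using mult_le_cancel2[of "r + 1" H "i + 1"] by (simp add: H_def)
    then have ri: "r \<le> i" by simp
    have "(r + 1) * H < (length W - i) * H"
    proof -
      have "K + 1 + q \<le> length (\<sigma> n W)" by (simp add: PS q_def)
      then show ?thesis using l2 ip(3) by (simp add: K_def)
    qed
    then have ir: "r + 1 < length W - i" using mult_less_cancel2 by blast
    obtain y where y: "range y \<subseteq> A n" "word y (- int i) (length W) = W"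
      by (rule word_extension[OF W ip(1)])
    have "sublist (word y (- int r) (2 * r + 1)) (word y (- int i) (length W))"
      using ri ir by (intro sublist_word) auto
    then have "word y (- int r) (2 * r + 1) \<in> language n"
      using y(2) m(1,2) by (auto simp: language_def W_def)
    moreover have y0: "y 0 = W ! i" using y(2) ip(1) by (metis ab_left_minus add.commute nth_word)
    moreover have "agree r ((shift ^^ p) (subst_seq (\<sigma> n) y)) x"
      unfolding agree_def
    proof (intro allI impI)
      fix j :: int assume j: "\<bar>j\<bar> \<le> int r"
      have rK: "r \<le> K" by (simp add: K_def H_def)
      define t where "t = nat (int q + j)"
      have t: "int t = int q + j" using j rK by (simp add: t_def q_def)
      have wi: "word y (- int i) i = take i W" using y(2) ip(1) by (metis less_imp_le take_word)
      have "start (\<sigma> n) y (- int i + int i) = start (\<sigma> n) y (- int i) + int (length (\<sigma> n (word y (- int i) i)))"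
        by (rule start_add[OF substitution_\<sigma> y(1)])
      then have "start (\<sigma> n) y (- int i) = - int (length (\<sigma> n (take i W)))"
        using start_0[OF substitution_\<sigma>, of n y] by (simp add: wi)
      then have e: "start (\<sigma> n) y (- int i) + int t = j + int p" using t ip(3) by simp
      have tl: "t < length (\<sigma> n W)" using t j rK by (simp add: PS q_def)
      then have "subst_seq (\<sigma> n) y (j + int p) = \<sigma> n W ! t"
        using subst_seq_word[OF substitution_\<sigma> y(1), of t "- int i" "length W"] by (simp add: y(2) e)
      also have "\<dots> = word x (- int K) (2 * K + 1) ! nat (int K + j)"
      proof -
        have "t = length P + nat (int K + j)" "nat (int K + j) < 2 * K + 1"
          using t j rK by (auto simp: q_def)
        then show ?thesis by (simp only: PS nth_append_length_plus) (simp add: nth_append)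
      qed
      also have "\<dots> = x j" using j rK by (subst nth_word) auto
      finally show "(shift ^^ p) (subst_seq (\<sigma> n) y) j = x j" by (simp add: funpow_shift)
    qed
    ultimately have "Q r (W ! i, p)" using y(1) by (auto simp: Q_def)
    then show ?thesis using Wi ip(2) by (intro bexI[of _ "(W ! i, p)"]) (auto simp: height_def)
  qed
  moreover have "Q r ap" if Qs: "Q s ap" and "r \<le> s" for r s ap
  proof -
    obtain y where y: "range y \<subseteq> A n" "word y (- int s) (2 * s + 1) \<in> language n" "y 0 = fst ap"
      "agree s ((shift ^^ snd ap) (subst_seq (\<sigma> n) y)) x"
      using Qs unfolding Q_def by blast
    have "sublist (word y (- int r) (2 * r + 1)) (word y (- int s) (2 * s + 1))"
      using that(2) by (intro sublist_word) auto
    then have "word y (- int r) (2 * r + 1) \<in> language n" using language_sublist[OF y(2)] by blast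
    then show ?thesis using y agree_mono[OF y(4) that(2)] unfolding Q_def by blast
  qed
  ultimately obtain ap where "ap \<in> (SIGMA a:A n. {..<height \<tau> n [a]})" "\<And>r. Q r ap"
    using antimono_pigeonhole[OF finite_tower_positions[of n], of Q] by metis
  then show ?thesis using that in_tower_limit[of "snd ap" n "fst ap" x] unfolding Q_def by auto
qed

lemma in_tower_closed:
  assumes "\<And>N. \<exists>z. agree N x z \<and> in_tower n z a p"
  shows "in_tower n x a p"
proof (rule in_tower_limit)
  show "p < height \<tau> n [a]" "a \<in> A n" using assms by (auto simp: in_tower_def)
  fix r
  obtain z where z: "agree r x z" "in_tower n z a p" using assms by blast
  then obtain y where "y \<in> level_shift A \<tau> n" "y 0 = a" "z = (shift ^^ p) (subst_seq (\<sigma> n) y)"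
    by (auto simp: in_tower_def tower_base_def)
  then show "\<exists>y. range y \<subseteq> A n \<and> word y (- int r) (2 * r + 1) \<in> language n \<and> y 0 = a \<and>
      agree r ((shift ^^ p) (subst_seq (\<sigma> n) y)) x"
    using z(1) agree_sym by (intro exI[of _ y]) (auto simp: level_shift_iff)
qed

end

section \<open>Errors along prefixes\<close>

context positive_directive_sequence
begin

definition prefix_errors :: "real \<Rightarrow> (nat \<Rightarrow> 'a \<Rightarrow> real) \<Rightarrow> nat \<Rightarrow> real set" where
  "prefix_errors \<alpha> \<rho> n = {int_dist (\<rho> n (u ! 0) - \<rho> n (u ! k) + \<alpha> * real (height \<tau> n (take k u))) | a u k.
     a \<in> A (n + 2) \<and> u \<in> lists (A n) \<and> length u = k + 1 \<and> prefix u (\<tau> n (\<tau> (n + 1) [a]))}"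

lemma two_level_lists: "a \<in> A (n + 2) \<Longrightarrow> \<tau> n (\<tau> (n + 1) [a]) \<in> lists (A n)"
  using \<tau>_lists[OF \<tau>_letter_lists[of a "Suc n"]] by simp

text \<open>
  A prefix is determined by its length, which turns the set into a finite indexed family.
\<close>

lemma prefix_errors_eq:
  "prefix_errors \<alpha> \<rho> n = (\<lambda>(a, k). let W = \<tau> n (\<tau> (n + 1) [a]) in
      int_dist (\<rho> n (W ! 0) - \<rho> n (W ! k) + \<alpha> * real (height \<tau> n (take k W))))
    ` (SIGMA a:A (n + 2). {..<length (\<tau> n (\<tau> (n + 1) [a]))})" (is "?L = ?f ` ?S")
proof (intro equalityI subsetI)
  fix r assume "r \<in> ?L"
  then obtain a u k where r: "r = int_dist (\<rho> n (u ! 0) - \<rho> n (u ! k) + \<alpha> * real (height \<tau> n (take k u)))"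
    and a: "a \<in> A (n + 2)" and u: "length u = k + 1" "prefix u (\<tau> n (\<tau> (n + 1) [a]))"
    unfolding prefix_errors_def by blast
  obtain v where v: "\<tau> n (\<tau> (n + 1) [a]) = u @ v" using u(2) by (auto elim: prefixE)
  then have "r = ?f (a, k)" using u(1) by (simp add: r nth_append Let_def)
  moreover have "(a, k) \<in> ?S" using a v u(1) by simp
  ultimately show "r \<in> ?f ` ?S" by blast
next
  fix r assume "r \<in> ?f ` ?S"
  then obtain a k where a: "a \<in> A (n + 2)" and k: "k < length (\<tau> n (\<tau> (n + 1) [a]))" and r: "r = ?f (a, k)"
    by blast
  define W where "W = \<tau> n (\<tau> (n + 1) [a])"
  define u where "u = take (k + 1) W"
  have u: "prefix u W" "length u = k + 1" "u ! 0 = W ! 0" "u ! k = W ! k" "take k u = take k W"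
    using k by (auto simp: u_def W_def take_is_prefix min_def)
  have "u \<in> lists (A n)" using two_level_lists[OF a]
    by (auto simp: u_def W_def in_lists_conv_set dest: in_set_takeD)
  moreover have "r = int_dist (\<rho> n (u ! 0) - \<rho> n (u ! k) + \<alpha> * real (height \<tau> n (take k u)))"
    unfolding r u(3-5) by (simp add: W_def Let_def)
  ultimately show "r \<in> ?L" unfolding prefix_errors_def using a u(1,2) unfolding W_def by blast
qed

lemma finite_prefix_errors: "finite (prefix_errors \<alpha> \<rho> n)"
  unfolding prefix_errors_eq by (intro finite_imageI finite_SigmaI finite_alphabet) auto

lemma two_level_nonempty: "a \<in> A (n + 2) \<Longrightarrow> \<tau> n (\<tau> (n + 1) [a]) \<noteq> []"
  using length_\<tau>_letter[of a "Suc n"] substitution_length_ge[OF substitution_\<tau> \<tau>_letter_lists[of a "Suc n"]]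
  by auto

lemma prefix_errors_nonempty: "prefix_errors \<alpha> \<rho> n \<noteq> {}"
  using alphabet_nonempty[of "n + 2"] two_level_nonempty unfolding prefix_errors_eq by fastforce

lemma Max_prefix_errors_nonneg: "0 \<le> Max (prefix_errors \<alpha> \<rho> n)"
proof -
  have "Max (prefix_errors \<alpha> \<rho> n) \<in> prefix_errors \<alpha> \<rho> n"
    by (rule Max_in[OF finite_prefix_errors prefix_errors_nonempty])
  then show ?thesis by (auto simp: prefix_errors_def)
qed

section \<open>Eigenfunctions on the bases of the towers\<close>

lemma tower_base_letter: "w \<in> tower_base A \<tau> n a \<Longrightarrow> a \<in> A n"
  using level_shift_range[of _ n] by (force simp: tower_base_def)

lemma tower_base_coordinate:
  assumes "w \<in> tower_base A \<tau> n a" "0 \<le> j" "j < int (height \<tau> n [a])"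
  shows "w j = \<sigma> n [a] ! nat j"
proof -
  obtain y where y: "y \<in> level_shift A \<tau> n" "y 0 = a" "w = subst_seq (\<sigma> n) y"
    using assms(1) by (auto simp: tower_base_def)
  then show ?thesis
    using subst_seq_letter[OF substitution_\<sigma> level_shift_range[OF y(1)], of "nat j" 0] assms(2,3)
      start_0[OF substitution_\<sigma>, of n y] by (simp add: height_def)
qed

lemma level_shift_0_shift: "x \<in> level_shift A \<tau> 0 \<Longrightarrow> shift x \<in> level_shift A \<tau> 0"
  using level_shift_funpow_shift[of x 0 1] by simp

lemma eigenfunction_funpow:
  assumes eig: "\<And>x. x \<in> level_shift A \<tau> 0 \<Longrightarrow> g (shift x) = g x + circle_of \<alpha>"
    and x: "x \<in> level_shift A \<tau> 0"
  shows "g ((shift ^^ k) x) = g x + circle_of (\<alpha> * real k)"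
proof (induction k)
  case 0
  then show ?case by (simp add: circle_of_0)
next
  case (Suc k)
  have "g ((shift ^^ Suc k) x) = g ((shift ^^ k) x) + circle_of \<alpha>"
    using eig[OF level_shift_funpow_shift[OF x, of k]] by simp
  then show ?case using Suc by (simp add: circle_of_add[symmetric] add.assoc algebra_simps)
qed

text \<open>
  Otherwise pairs that agree on longer and longer windows keep their values apart, while both
  members of the pairs cluster at one point.
\<close>

lemma uniformly_continuous_circle:
  fixes g :: "(int \<Rightarrow> 'a) \<Rightarrow> circle"
  assumes g: "\<And>x e. x \<in> level_shift A \<tau> 0 \<Longrightarrow> e > 0 \<Longrightarrow>
      \<exists>N. \<forall>y\<in>level_shift A \<tau> 0. agree N x y \<longrightarrow> \<bar>centered_lift (g y - g x)\<bar> < e"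
    and e: "e > 0"
  obtains N where "\<And>x y. x \<in> level_shift A \<tau> 0 \<Longrightarrow> y \<in> level_shift A \<tau> 0 \<Longrightarrow> agree N x y \<Longrightarrow>
      \<bar>centered_lift (g x - g y)\<bar> < e"
proof -
  have "\<exists>N. \<forall>x\<in>level_shift A \<tau> 0. \<forall>y\<in>level_shift A \<tau> 0. agree N x y \<longrightarrow> \<bar>centered_lift (g x - g y)\<bar> < e"
  proof (rule ccontr)
    assume "\<not> ?thesis"
    then obtain x y where xy: "\<And>N. x N \<in> level_shift A \<tau> 0" "\<And>N. y N \<in> level_shift A \<tau> 0"
      "\<And>N. agree N (x N) (y N)" "\<And>N. \<not> \<bar>centered_lift (g (x N) - g (y N))\<bar> < e" by metis
    obtain z where z: "z \<in> level_shift A \<tau> 0" "\<And>r. \<exists>R\<ge>r. agree r (x R) z"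
      using level_shift_limit[of x 0] xy(1) by (metis level_shift_iff)
    obtain M where M: "\<And>y. y \<in> level_shift A \<tau> 0 \<Longrightarrow> agree M z y \<Longrightarrow> \<bar>centered_lift (g y - g z)\<bar> < e / 2"
      using g[OF z(1), of "e / 2"] e by auto
    obtain R where R: "R \<ge> M" "agree M (x R) z" using z(2) by blast
    have "agree M z (x R)" "agree M z (y R)"
      using R agree_mono[OF xy(3)[of R] R(1)] agree_sym agree_trans by blast+
    then have "\<bar>centered_lift (g (x R) - g z)\<bar> < e / 2" "\<bar>centered_lift (g (y R) - g z)\<bar> < e / 2"
      using M xy by auto
    then have "\<bar>centered_lift (g (x R) - g (y R))\<bar> < e"
      using abs_centered_lift_add[of "g (x R) - g z" "g z - g (y R)"]
        abs_centered_lift_diff_commute[of "g z" "g (y R)"] by simp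
    then show False using xy(4) by blast
  qed
  then show ?thesis using that by blast
qed

text \<open>
  A base \<open>B n a\<close> is not small: it fixes no coordinate to the left of the origin. But \<open>S^M\<close> moves
  the known word \<open>\<sigma> n [a]\<close> to a window around the origin, and an eigenfunction commutes with
  \<open>S^M\<close> up to a constant.
\<close>

lemma eigenfunction_tower_base:
  fixes g :: "(int \<Rightarrow> 'a) \<Rightarrow> circle"
  assumes g: "\<And>x e. x \<in> level_shift A \<tau> 0 \<Longrightarrow> e > 0 \<Longrightarrow>
      \<exists>N. \<forall>y\<in>level_shift A \<tau> 0. agree N x y \<longrightarrow> \<bar>centered_lift (g y - g x)\<bar> < e"
    and eig: "\<And>x. x \<in> level_shift A \<tau> 0 \<Longrightarrow> g (shift x) = g x + circle_of \<alpha>"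
    and e: "e > 0"
  obtains N where "\<And>n a v w. n \<ge> N \<Longrightarrow> v \<in> tower_base A \<tau> n a \<Longrightarrow> w \<in> tower_base A \<tau> n a \<Longrightarrow>
      \<bar>centered_lift (g v - g w)\<bar> < e"
proof -
  obtain M where M: "\<And>x y. x \<in> level_shift A \<tau> 0 \<Longrightarrow> y \<in> level_shift A \<tau> 0 \<Longrightarrow> agree M x y \<Longrightarrow>
      \<bar>centered_lift (g x - g y)\<bar> < e"
    using uniformly_continuous_circle[of g e] g e by metis
  have "\<bar>centered_lift (g v - g w)\<bar> < e"
    if n: "n \<ge> 2 * M + 1" and vw: "v \<in> tower_base A \<tau> n a" "w \<in> tower_base A \<tau> n a" for n a v w
  proof -
    have X: "v \<in> level_shift A \<tau> 0" "w \<in> level_shift A \<tau> 0" using vw tower_base_subset by auto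
    have h: "height \<tau> n [a] > 2 * M + 1" using height_letter[OF tower_base_letter[OF vw(1)]] n by simp
    have "agree M ((shift ^^ M) v) ((shift ^^ M) w)"
      using h tower_base_coordinate[OF vw(1)] tower_base_coordinate[OF vw(2)]
      by (auto simp: agree_def funpow_shift)
    then have "\<bar>centered_lift (g ((shift ^^ M) v) - g ((shift ^^ M) w))\<bar> < e"
      using X by (intro M level_shift_funpow_shift)
    then show ?thesis
      using eigenfunction_funpow[of g, OF eig X(1)] eigenfunction_funpow[of g, OF eig X(2)] by simp
  qed
  then show ?thesis using that by blast
qed

end

section \<open>Eigenvalues have summable errors\<close>

text \<open>
  With the bound \<open>1/16\<close>, deficits lie in \<open>[0, 1/8]\<close>. A difference of two deficits and a representative
  in \<open>[-1/2, 1/2]\<close> then differ by less than one, so they are equal if they are equal modulo the integers.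
\<close>

locale eigenfunction_small_on_bases = positive_directive_sequence +
  fixes g :: "(int \<Rightarrow> 'a) \<Rightarrow> circle" and \<alpha> :: real and n0 :: nat
  assumes eigenfunction: "x \<in> level_shift A \<tau> 0 \<Longrightarrow> g (shift x) = g x + circle_of \<alpha>"
    and small: "n \<ge> n0 \<Longrightarrow> v \<in> tower_base A \<tau> n a \<Longrightarrow> w \<in> tower_base A \<tau> n a \<Longrightarrow>
      \<bar>centered_lift (g v - g w)\<bar> < 1 / 16"
begin

definition base_point :: "nat \<Rightarrow> 'a \<Rightarrow> int \<Rightarrow> 'a" where
  "base_point n a = (SOME w. w \<in> tower_base A \<tau> n a)"

text \<open>
  On a base, \<open>g\<close> takes values in a short arc. The arc is lifted to the reals around the value at
  \<open>base_point n a\<close>, and \<open>top_value n a\<close> is the supremum of this lift of \<open>g\<close>.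
\<close>

definition sup_offset :: "nat \<Rightarrow> 'a \<Rightarrow> real" where
  "sup_offset n a = (SUP w\<in>tower_base A \<tau> n a. centered_lift (g w - g (base_point n a)))"

definition top_value :: "nat \<Rightarrow> 'a \<Rightarrow> real" where
  "top_value n a = centered_lift (g (base_point n a)) + sup_offset n a"

definition deficit :: "nat \<Rightarrow> 'a \<Rightarrow> (int \<Rightarrow> 'a) \<Rightarrow> real" where
  "deficit n a w = sup_offset n a - centered_lift (g w - g (base_point n a))"

lemma base_point: "a \<in> A n \<Longrightarrow> base_point n a \<in> tower_base A \<tau> n a"
  using tower_base_nonempty[of a n] unfolding base_point_def by (simp add: some_in_eq)

lemma offset_bound:
  assumes "n \<ge> n0" "w \<in> tower_base A \<tau> n a"
  shows "\<bar>centered_lift (g w - g (base_point n a))\<bar> < 1 / 16"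
  using small[OF assms base_point] tower_base_letter[OF assms(2)] by blast

lemma bdd_above_offset:
  assumes "n \<ge> n0"
  shows "bdd_above ((\<lambda>w. centered_lift (g w - g (base_point n a))) ` tower_base A \<tau> n a)"
proof (rule bdd_aboveI2)
  fix w assume "w \<in> tower_base A \<tau> n a"
  then show "centered_lift (g w - g (base_point n a)) \<le> 1 / 16" using offset_bound[OF assms] by force
qed

lemma deficit_bounds:
  assumes n: "n \<ge> n0" and w: "w \<in> tower_base A \<tau> n a"
  shows "0 \<le> deficit n a w" "deficit n a w \<le> 1 / 8"
proof -
  show "0 \<le> deficit n a w"
    using cSUP_upper[OF w bdd_above_offset[OF n]] by (simp add: deficit_def sup_offset_def)
  have "sup_offset n a \<le> 1 / 16" unfolding sup_offset_def
  proof (rule cSUP_least)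
    fix w assume "w \<in> tower_base A \<tau> n a"
    then show "centered_lift (g w - g (base_point n a)) \<le> 1 / 16" using offset_bound[OF n] by force
  qed (use w in auto)
  then show "deficit n a w \<le> 1 / 8" using offset_bound[OF n w] by (simp add: deficit_def)
qed

lemma circle_of_deficit: "circle_of (deficit n a w) = circle_of (top_value n a) - g w"
  by (simp add: deficit_def top_value_def circle_of_diff circle_of_add)

lemma deficit_small:
  assumes n: "n \<ge> n0" and a: "a \<in> A n" and "\<eta> > 0"
  obtains w where "w \<in> tower_base A \<tau> n a" "deficit n a w < \<eta>"
proof -
  have "sup_offset n a - \<eta> < sup_offset n a" using \<open>\<eta> > 0\<close> by simp
  then obtain w where "w \<in> tower_base A \<tau> n a" "sup_offset n a - \<eta> < centered_lift (g w - g (base_point n a))"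
    using less_cSUP_iff[OF tower_base_nonempty[OF a] bdd_above_offset[OF n]]
    unfolding sup_offset_def by blast
  then show ?thesis using that by (force simp: deficit_def)
qed

definition edge_cost :: "nat \<Rightarrow> 'a \<Rightarrow> nat \<Rightarrow> real" where
  "edge_cost n b i = centered_lift (circle_of
     (top_value n (\<tau> n [b] ! i) - top_value (Suc n) b - \<alpha> * real (height \<tau> n (take i (\<tau> n [b])))))"

text \<open>
  The cost of an edge is the same for all points that use it: modulo the integers because
  \<open>g\<close> is an eigenfunction, and then as a real number because both sides are small.
\<close>

lemma deficit_descend:
  assumes n: "n \<ge> n0" and w: "w \<in> tower_base A \<tau> (Suc n) b" and i: "i < length (\<tau> n [b])"
  shows "deficit n (\<tau> n [b] ! i) ((shift ^^ height \<tau> n (take i (\<tau> n [b]))) w)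
    = deficit (Suc n) b w + edge_cost n b i"
proof -
  define h where "h = height \<tau> n (take i (\<tau> n [b]))"
  define w' where "w' = (shift ^^ h) w"
  have w': "w' \<in> tower_base A \<tau> n (\<tau> n [b] ! i)"
    unfolding w'_def h_def using w i by (rule tower_base_descend)
  have gw: "g w' = g w + circle_of (\<alpha> * real h)"
    unfolding w'_def using eigenfunction w tower_base_subset[of "Suc n" b] by (intro eigenfunction_funpow) auto
  define D where "D = deficit n (\<tau> n [b] ! i) w' - deficit (Suc n) b w"
  have "circle_of D = circle_of (edge_cost n b i)"
    by (simp add: D_def edge_cost_def circle_of_diff circle_of_add circle_of_deficit gw h_def[symmetric] algebra_simps)
  moreover have "\<bar>D\<bar> \<le> 1 / 8"
    using deficit_bounds[OF n w'] deficit_bounds[OF le_SucI[OF n] w] unfolding D_def by linarith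
  moreover have "\<bar>edge_cost n b i\<bar> \<le> 1 / 2" by (simp only: edge_cost_def abs_centered_lift_le_half)
  ultimately have "D = edge_cost n b i" by (intro circle_of_inject_small) auto
  then show ?thesis by (simp add: D_def w'_def h_def)
qed

text \<open>
  A point of \<open>B (n + 1) b\<close> whose deficit is nearly zero still has a non-negative deficit after
  the passage to level \<open>n\<close>.
\<close>

lemma edge_cost_nonneg:
  assumes n: "n \<ge> n0" and b: "b \<in> A (Suc n)" and i: "i < length (\<tau> n [b])"
  shows "0 \<le> edge_cost n b i"
proof (rule ccontr)
  assume neg: "\<not> 0 \<le> edge_cost n b i"
  obtain w where w: "w \<in> tower_base A \<tau> (Suc n) b" "deficit (Suc n) b w < - edge_cost n b i"
    using deficit_small[of "Suc n" b "- edge_cost n b i"] n b neg by force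
  then show False
    using deficit_descend[OF n w(1) i] deficit_bounds(1)[OF n tower_base_descend[OF w(1) i]] by linarith
qed

definition max_cost :: "nat \<Rightarrow> real" where
  "max_cost n = Max ((\<lambda>(b, i). edge_cost n b i) ` (SIGMA b:A (Suc n). {..<length (\<tau> n [b])}))"

lemma finite_edges: "finite (SIGMA b:A (Suc n). {..<length (\<tau> n [b])})"
  by (intro finite_SigmaI finite_alphabet) auto

lemma edge_cost_le_max: "b \<in> A (Suc n) \<Longrightarrow> i < length (\<tau> n [b]) \<Longrightarrow> edge_cost n b i \<le> max_cost n"
  unfolding max_cost_def using finite_edges[of n] by (intro Max_ge) (auto simp: image_iff)

lemma max_cost_attained:
  obtains b i where "b \<in> A (Suc n)" "i < length (\<tau> n [b])" "edge_cost n b i = max_cost n"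
proof -
  have "(SIGMA b:A (Suc n). {..<length (\<tau> n [b])}) \<noteq> {}"
    using alphabet_nonempty[of "Suc n"] length_\<tau>_letter[of _ n] by fastforce
  then have "max_cost n \<in> (\<lambda>(b, i). edge_cost n b i) ` (SIGMA b:A (Suc n). {..<length (\<tau> n [b])})"
    unfolding max_cost_def using finite_edges[of n] by (intro Max_in) auto
  then show ?thesis using that by auto
qed

lemma max_cost_nonneg: "n \<ge> n0 \<Longrightarrow> 0 \<le> max_cost n"
  using max_cost_attained[of n] edge_cost_nonneg[of n] by metis

text \<open>
  The descent uses a worst edge between the levels \<open>n + 2 i + 1\<close> and \<open>n + 2 i\<close> for each \<open>i\<close>. Positivity
  supplies, between the levels \<open>n + 2 i + 2\<close> and \<open>n + 2 i + 1\<close>, an edge from the end of one worst edge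
  to the beginning of the next; as costs are non-negative it can only increase the total.
\<close>

lemma descend_worst_edges:
  assumes n: "n \<ge> n0" and w: "w \<in> tower_base A \<tau> (n + 2 * j) c"
  shows "\<exists>a v. v \<in> tower_base A \<tau> n a \<and> (\<Sum>i<j. max_cost (n + 2 * i)) + deficit (n + 2 * j) c w \<le> deficit n a v"
  using w
proof (induction j arbitrary: c w)
  case 0
  then show ?case by auto
next
  case (Suc j)
  define m where "m = n + 2 * j"
  have m: "m \<ge> n0" "Suc m \<ge> n0" using n by (auto simp: m_def)
  have w: "w \<in> tower_base A \<tau> (Suc (Suc m)) c" using Suc.prems by (simp add: m_def)
  obtain b i where b: "b \<in> A (Suc m)" "i < length (\<tau> m [b])" "edge_cost m b i = max_cost m"
    by (rule max_cost_attained)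
  have c: "c \<in> A (Suc (Suc m))" using w by (rule tower_base_letter)
  obtain k where k: "k < length (\<tau> (Suc m) [c])" "\<tau> (Suc m) [c] ! k = b"
    using \<tau>_positive[OF b(1) c] by (metis in_set_conv_nth)
  define v where "v = (shift ^^ height \<tau> (Suc m) (take k (\<tau> (Suc m) [c]))) w"
  have v: "v \<in> tower_base A \<tau> (Suc m) b" "deficit (Suc m) b v = deficit (Suc (Suc m)) c w + edge_cost (Suc m) c k"
    using tower_base_descend[OF w k(1)] deficit_descend[OF m(2) w k(1)] by (simp_all add: v_def k(2))
  define a where "a = \<tau> m [b] ! i"
  define u where "u = (shift ^^ height \<tau> m (take i (\<tau> m [b]))) v"
  have u: "u \<in> tower_base A \<tau> m a" "deficit m a u = deficit (Suc m) b v + max_cost m"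
    using tower_base_descend[OF v(1) b(2)] deficit_descend[OF m(1) v(1) b(2)] b(3) by (simp_all add: u_def a_def)
  obtain a' v' where "v' \<in> tower_base A \<tau> n a'" "(\<Sum>i<j. max_cost (n + 2 * i)) + deficit m a u \<le> deficit n a' v'"
    using Suc.IH[of u a] u(1) by (auto simp: m_def)
  moreover have "deficit m a u \<ge> deficit (Suc (Suc m)) c w + max_cost m"
    using u v edge_cost_nonneg[OF m(2) c k(1)] by simp
  ultimately show ?case by (intro exI[of _ a'] exI[of _ v']) (simp add: m_def)
qed

lemma sum_alternate_max_cost:
  assumes n: "n \<ge> n0"
  shows "(\<Sum>i<j. max_cost (n + 2 * i)) \<le> 1 / 8"
proof -
  obtain c where "c \<in> A (n + 2 * j)" using alphabet_nonempty by blast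
  then obtain w where w: "w \<in> tower_base A \<tau> (n + 2 * j) c" using tower_base_nonempty by blast
  obtain a v where "v \<in> tower_base A \<tau> n a"
      "(\<Sum>i<j. max_cost (n + 2 * i)) + deficit (n + 2 * j) c w \<le> deficit n a v"
    using descend_worst_edges[OF n w] by blast
  then show ?thesis
    using deficit_bounds(2)[OF n, of v a] deficit_bounds(1)[OF _ w] n by simp
qed

lemma summable_max_cost: "summable max_cost"
proof -
  have "summable (\<lambda>i. max_cost (i + n0))"
  proof (rule summableI_nonneg_bounded)
    show "0 \<le> max_cost (i + n0)" for i by (rule max_cost_nonneg) simp
    fix j
    have "(\<Sum>i<j. max_cost (i + n0)) \<le> (\<Sum>i<2 * j. max_cost (i + n0))"
      by (rule sum_mono2) (auto intro: max_cost_nonneg)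
    also have "\<dots> = (\<Sum>i<j. max_cost (n0 + 2 * i)) + (\<Sum>i<j. max_cost (Suc n0 + 2 * i))"
      by (induction j) (auto simp: algebra_simps)
    also have "\<dots> \<le> 1 / 8 + 1 / 8"
      by (intro add_mono sum_alternate_max_cost) auto
    finally show "(\<Sum>i<j. max_cost (i + n0)) \<le> 1 / 4" by simp
  qed
  then show ?thesis by (simp add: summable_iff_shift)
qed

text \<open>
  All points of the orbit of \<open>w\<close> that lie in bases of level \<open>n\<close>, within the tower of \<open>c\<close>, have
  nearly the same deficit, since each is reached from \<open>w\<close> by two edges.
\<close>

lemma deficit_descend_two:
  assumes n: "n \<ge> n0" and w: "w \<in> tower_base A \<tau> (n + 2) c" and t: "t < length (\<tau> n (\<tau> (n + 1) [c]))"
  defines "W \<equiv> \<tau> n (\<tau> (n + 1) [c])"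
  defines "v \<equiv> (shift ^^ height \<tau> n (take t W)) w"
  shows "deficit (n + 2) c w \<le> deficit n (W ! t) v"
    "deficit n (W ! t) v \<le> deficit (n + 2) c w + max_cost n + max_cost (Suc n)"
proof -
  have w: "w \<in> tower_base A \<tau> (Suc (Suc n)) c" using w by simp
  have c: "c \<in> A (Suc (Suc n))" using w by (rule tower_base_letter)
  define V where "V = \<tau> (Suc n) [c]"
  have V: "V \<in> lists (A (Suc n))" using c by (simp add: V_def \<tau>_letter_lists)
  have WV: "W = \<tau> n V" by (simp add: W_def V_def)
  have "t < length (\<tau> n V)" using t by (simp add: V_def)
  then obtain i j where ij: "i < length V" "j < length (\<tau> n [V ! i])" "t = length (\<tau> n (take i V)) + j"
    "\<tau> n V ! t = \<tau> n [V ! i] ! j" "take t (\<tau> n V) = \<tau> n (take i V) @ take j (\<tau> n [V ! i])"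
    by (rule substitution_position[OF substitution_\<tau> V])
  have Vi: "V ! i \<in> A (Suc n)" using V ij(1) by (auto simp: in_lists_conv_set)
  have "take i V \<in> lists (A (Suc n))" "take j (\<tau> n [V ! i]) \<in> lists (A n)"
    using V \<tau>_letter_lists[OF Vi] by (auto simp: in_lists_conv_set dest: in_set_takeD)
  then have h: "height \<tau> n (take t W) = height \<tau> (Suc n) (take i V) + height \<tau> n (take j (\<tau> n [V ! i]))"
    using ij(5) \<tau>_lists by (simp add: WV height_append height_Suc)
  define x where "x = (shift ^^ height \<tau> (Suc n) (take i V)) w"
  have x: "x \<in> tower_base A \<tau> (Suc n) (V ! i)" "deficit (Suc n) (V ! i) x = deficit (n + 2) c w + edge_cost (Suc n) c i"
    using tower_base_descend[OF w, of i] deficit_descend[OF _ w, of i] ij(1) n by (simp_all add: x_def V_def)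
  have "v = (shift ^^ height \<tau> n (take j (\<tau> n [V ! i]))) x"
    unfolding v_def x_def h by (subst add.commute) (simp add: funpow_add)
  then have "deficit n (W ! t) v = deficit (Suc n) (V ! i) x + edge_cost n (V ! i) j"
    using deficit_descend[OF n x(1) ij(2)] ij(4) by (simp add: WV)
  moreover have "edge_cost (Suc n) c i \<le> max_cost (Suc n)" "edge_cost n (V ! i) j \<le> max_cost n"
    using c ij Vi by (auto intro: edge_cost_le_max simp: V_def)
  moreover have "0 \<le> edge_cost (Suc n) c i" "0 \<le> edge_cost n (V ! i) j"
    using c ij Vi n by (auto intro!: edge_cost_nonneg simp: V_def)
  ultimately show "deficit (n + 2) c w \<le> deficit n (W ! t) v"
    "deficit n (W ! t) v \<le> deficit (n + 2) c w + max_cost n + max_cost (Suc n)"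
    using x(2) by linarith+
qed

lemma prefix_errors_top_value_le:
  assumes n: "n \<ge> n0" and r: "r \<in> prefix_errors \<alpha> top_value n"
  shows "r \<le> max_cost n + max_cost (Suc n)"
proof -
  obtain c k where c: "c \<in> A (n + 2)" and k: "k < length (\<tau> n (\<tau> (n + 1) [c]))"
    and r: "r = (let W = \<tau> n (\<tau> (n + 1) [c]) in
      int_dist (top_value n (W ! 0) - top_value n (W ! k) + \<alpha> * real (height \<tau> n (take k W))))"
    using r unfolding prefix_errors_eq by auto
  define W where "W = \<tau> n (\<tau> (n + 1) [c])"
  obtain w where w: "w \<in> tower_base A \<tau> (n + 2) c" using tower_base_nonempty[OF c] by blast
  define h where "h = height \<tau> n (take k W)"
  define D where "D = deficit n (W ! 0) w - deficit n (W ! k) ((shift ^^ h) w)"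
  have z: "height \<tau> n (take 0 W) = 0" by (simp add: height_def substitution_Nil[OF substitution_\<sigma>])
  have W0: "0 < length W" using k unfolding W_def by linarith
  have "\<bar>D\<bar> \<le> max_cost n + max_cost (Suc n)"
    using deficit_descend_two[OF n w k] deficit_descend_two[OF n w W0[unfolded W_def]]
    unfolding W_def[symmetric] h_def[symmetric] z D_def by simp
  moreover have "g ((shift ^^ h) w) = g w + circle_of (\<alpha> * real h)"
    using eigenfunction w tower_base_subset[of "n + 2" c] by (intro eigenfunction_funpow) auto
  then have "circle_of D = circle_of (top_value n (W ! 0) - top_value n (W ! k) + \<alpha> * real h)"
    by (simp add: D_def circle_of_diff circle_of_add circle_of_deficit algebra_simps)
  then have "int_dist D = r"
    unfolding r W_def[symmetric] Let_def h_def[symmetric] circle_of_eq_iff by (rule int_dist_cong)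
  ultimately show ?thesis using int_dist_le_abs[of D] by simp
qed

lemma summable_prefix_errors_top_value: "summable (\<lambda>n. Max (prefix_errors \<alpha> top_value n))"
proof (rule summable_comparison_test'[where N = n0])
  show "summable (\<lambda>n. max_cost n + max_cost (Suc n))"
    using summable_max_cost by (intro summable_add) (simp_all add: summable_Suc_iff)
  fix n assume n: "n \<ge> n0"
  have "Max (prefix_errors \<alpha> top_value n) \<le> max_cost n + max_cost (Suc n)"
    using prefix_errors_top_value_le[OF n] finite_prefix_errors prefix_errors_nonempty by (subst Max_le_iff) auto
  then show "norm (Max (prefix_errors \<alpha> top_value n)) \<le> max_cost n + max_cost (Suc n)"
    using Max_prefix_errors_nonneg[of \<alpha> top_value n] by simp
qed

end

section \<open>Positions in the towers of a recognizable sequence\<close>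

text \<open>
  Completeness of the circle: replacing each increment by its representative of least absolute
  value turns the sequence into a convergent one without changing it modulo the integers.
\<close>

lemma circle_series_limit:
  fixes \<gamma> E :: "nat \<Rightarrow> real"
  assumes E: "summable E" and step: "\<And>n. int_dist (\<gamma> (Suc n) - \<gamma> n) \<le> E n"
  obtains G where "\<And>n. int_dist (G - \<gamma> n) \<le> (\<Sum>i. E (i + n))"
proof -
  define r where "r = (\<lambda>n. \<gamma> (Suc n) - \<gamma> n - of_int (round (\<gamma> (Suc n) - \<gamma> n)))"
  have rE: "norm (r n) \<le> E n" for n
    using step[of n] by (simp add: r_def int_dist_def)
  have r: "summable r" using summable_comparison_test[OF _ E] rE by blast
  have rn: "summable (\<lambda>i. norm (r (i + n)))" "summable (\<lambda>i. E (i + n))" for n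
  proof -
    show En: "summable (\<lambda>i. E (i + n))" using E by (simp add: summable_iff_shift)
    show "summable (\<lambda>i. norm (r (i + n)))"
      using rE by (intro summable_comparison_test[OF _ En]) auto
  qed
  have "int_dist (\<gamma> 0 + (\<Sum>i. r i) - \<gamma> n) \<le> (\<Sum>i. E (i + n))" for n
  proof -
    have "\<gamma> 0 + (\<Sum>i<n. r i) - \<gamma> n \<in> \<int>"
    proof (induction n)
      case (Suc n)
      have "\<gamma> 0 + (\<Sum>i<Suc n. r i) - \<gamma> (Suc n)
          = (\<gamma> 0 + (\<Sum>i<n. r i) - \<gamma> n) - of_int (round (\<gamma> (Suc n) - \<gamma> n))"
        by (simp add: r_def)
      then show ?case by (simp only:) (intro Ints_diff Suc.IH Ints_of_int)
    qed simp
    then have "int_dist (\<gamma> 0 + (\<Sum>i. r i) - \<gamma> n) = int_dist (\<Sum>i. r (i + n))"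
      by (intro int_dist_cong) (simp add: suminf_split_initial_segment[OF r, of n] algebra_simps)
    also have "\<dots> \<le> norm (\<Sum>i. r (i + n))" using int_dist_le_abs by simp
    also have "\<dots> \<le> (\<Sum>i. norm (r (i + n)))" by (rule summable_norm[OF rn(1)])
    also have "\<dots> \<le> (\<Sum>i. E (i + n))" using rE by (intro suminf_le rn)
    finally show ?thesis .
  qed
  then show ?thesis by (rule that)
qed

locale recognizable_directive_sequence = positive_directive_sequence +
  assumes recognizable: "recognizable A \<tau>"
begin

lemma in_tower_unique:
  assumes n: "n \<ge> 1" and ab: "in_tower n x a p" "in_tower n x b q"
  shows "a = b \<and> p = q"
proof -
  have "disjoint_family_on (\<lambda>(a, k). (shift ^^ k) ` tower_base A \<tau> n a) (SIGMA a:A n. {..<height \<tau> n [a]})"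
    using recognizable n by (simp add: recognizable_def)
  then show ?thesis
    using disjoint_family_onD[of "\<lambda>(a, k). (shift ^^ k) ` tower_base A \<tau> n a" _ "(a, p)" "(b, q)"] ab
    unfolding in_tower_def by fastforce
qed

definition position :: "nat \<Rightarrow> (int \<Rightarrow> 'a) \<Rightarrow> 'a \<times> nat" where
  "position n x = (THE ap. in_tower n x (fst ap) (snd ap))"

lemma position_eqI: "n \<ge> 1 \<Longrightarrow> in_tower n x a p \<Longrightarrow> position n x = (a, p)"
proof -
  assume n: "n \<ge> 1" and ap: "in_tower n x a p"
  have "bq = (a, p)" if "in_tower n x (fst bq) (snd bq)" for bq
    using in_tower_unique[OF n that ap] by (simp add: prod_eq_iff)
  then show ?thesis unfolding position_def using ap by (intro the_equality) auto
qed

lemma in_tower_position: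
  assumes "n \<ge> 1" "x \<in> level_shift A \<tau> 0"
  shows "in_tower n x (fst (position n x)) (snd (position n x))"
  using in_tower_exists[OF assms(2), of n] position_eqI[OF assms(1)] by (metis fst_conv snd_conv)

text \<open>
  Recognizability makes the finitely many closed sets \<open>S\<^sup>p B n a\<close> a partition, so they are open.
\<close>

lemma position_locally_constant:
  assumes n: "n \<ge> 1" and x: "x \<in> level_shift A \<tau> 0"
  obtains N where "\<And>y. y \<in> level_shift A \<tau> 0 \<Longrightarrow> agree N x y \<Longrightarrow> position n y = position n x"
proof -
  have "\<exists>N. \<forall>y\<in>level_shift A \<tau> 0. agree N x y \<longrightarrow> position n y = position n x"
  proof (rule ccontr)
    assume not: "\<not> ?thesis"
    define Q where "Q = (\<lambda>N ap. \<exists>y\<in>level_shift A \<tau> 0. agree N x y \<and> position n y = ap \<and> ap \<noteq> position n x)"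
    have "\<exists>ap\<in>(SIGMA a:A n. {..<height \<tau> n [a]}). Q N ap" for N
    proof -
      obtain y where y: "y \<in> level_shift A \<tau> 0" "agree N x y" "position n y \<noteq> position n x" using not by blast
      then have "position n y \<in> (SIGMA a:A n. {..<height \<tau> n [a]})"
        using in_tower_position[OF n y(1)] by (cases "position n y") (auto simp: in_tower_def)
      then show ?thesis unfolding Q_def
        by (rule bexI[rotated]) (rule bexI[OF _ y(1)], use y in simp)
    qed
    moreover have "Q r ap" if "Q s ap" "r \<le> s" for r s ap
      using that agree_mono unfolding Q_def by blast
    ultimately obtain ap where ap: "\<And>N. Q N ap"
      using antimono_pigeonhole[OF finite_tower_positions[of n], of Q] by metis
    have "in_tower n x (fst ap) (snd ap)"
    proof (rule in_tower_closed)
      show "\<exists>z. agree N x z \<and> in_tower n z (fst ap) (snd ap)" for N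
        using ap[of N] in_tower_position[OF n] unfolding Q_def by blast
    qed
    then have "position n x = ap" using position_eqI[OF n] by simp
    then show False using ap[of 0] unfolding Q_def by blast
  qed
  then show ?thesis using that by blast
qed

definition below_top :: "nat \<Rightarrow> (int \<Rightarrow> 'a) \<Rightarrow> bool" where
  "below_top n x \<longleftrightarrow> (\<exists>a p. in_tower n x a p \<and> Suc p < height \<tau> n [a])"

text \<open>
  A central window of \<open>x\<close>, one letter longer on the right, occurs in some \<open>\<sigma> m [c]\<close>. Any point of
  \<open>B m c\<close> can be moved so that its origin is at the centre of that occurrence, and the extra letter
  keeps it below the top.
\<close>

lemma below_top_dense:
  assumes x: "x \<in> level_shift A \<tau> 0"
  obtains y m where "y \<in> level_shift A \<tau> 0" "agree N x y" "m \<ge> 1" "below_top m y"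
proof -
  have "word x (- int N) (2 * N + 2) \<in> language 0" using x by (simp add: level_shift_iff)
  then obtain m c where m: "m \<ge> 1" "c \<in> A m" and sub: "sublist (word x (- int N) (2 * N + 2)) (\<sigma> m [c])"
    using language_late[where M = 0] by (metis One_nat_def Suc_leI)
  obtain P S where PS: "\<sigma> m [c] = P @ word x (- int N) (2 * N + 2) @ S"
    using sub by (auto simp: sublist_def)
  define q where "q = length P + N"
  have h: "height \<tau> m [c] \<ge> length P + (2 * N + 2)" by (simp add: height_def PS)
  obtain w where w: "w \<in> tower_base A \<tau> m c" using tower_base_nonempty[OF m(2)] by blast
  define y where "y = (shift ^^ q) w"
  have t: "in_tower m y c q" using h w m(2) by (auto simp: in_tower_def q_def y_def)
  have "agree N x y" unfolding agree_def
  proof (intro allI impI)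
    fix j :: int assume j: "\<bar>j\<bar> \<le> int N"
    define t where "t = nat (int N + j)"
    have t: "nat (j + int q) = length P + t" "t < 2 * N + 2" using j by (auto simp: t_def q_def)
    have "y j = \<sigma> m [c] ! (length P + t)"
      using tower_base_coordinate[OF w, of "j + int q"] j h t by (simp add: y_def funpow_shift q_def)
    also have "\<dots> = word x (- int N) (2 * N + 2) ! t"
      using t(2) by (simp only: PS nth_append_length_plus) (simp add: nth_append)
    also have "\<dots> = x j" using t(2) j by (subst nth_word) (auto simp: t_def)
    finally show "x j = y j" by simp
  qed
  moreover have "below_top m y" unfolding below_top_def
    using t h by (intro exI[of _ c] exI[of _ q]) (simp add: q_def)
  moreover have "y \<in> level_shift A \<tau> 0"
    using w tower_base_subset level_shift_funpow_shift unfolding y_def by blast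
  ultimately show ?thesis using that m(1) by blast
qed

text \<open>
  A level of the tower of \<open>\<tau> n [b] ! i\<close> that is below the top remains below the top when this tower is
  stacked into the tower of \<open>b\<close>.
\<close>

lemma below_top_Suc:
  assumes n: "n \<ge> 1" and x: "x \<in> level_shift A \<tau> 0" and b: "below_top n x"
  shows "below_top (Suc n) x"
proof -
  obtain b q where bq: "in_tower (Suc n) x b q" using in_tower_exists[OF x] .
  obtain i p where ip: "i < length (\<tau> n [b])" "q = height \<tau> n (take i (\<tau> n [b])) + p" "in_tower n x (\<tau> n [b] ! i) p"
    by (rule in_tower_descend[OF bq])
  have p: "Suc p < height \<tau> n [\<tau> n [b] ! i]"
    using b in_tower_unique[OF n ip(3)] by (auto simp: below_top_def)
  have "b \<in> A (Suc n)" using bq by (simp add: in_tower_def)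
  then have "Suc q < height \<tau> (Suc n) [b]"
    using substitution_prefix_of_position(1)[OF substitution_\<sigma> \<tau>_letter_lists ip(1), of "Suc p"] p
    by (simp only: height_Suc) (simp add: height_def ip(2))
  then show ?thesis using bq unfolding below_top_def by blast
qed

lemma below_top_mono:
  assumes "m \<ge> n" "n \<ge> 1" "x \<in> level_shift A \<tau> 0" "below_top n x"
  shows "below_top m x"
  using assms by (induction m rule: dec_induct) (auto intro: below_top_Suc)

lemma position_shift:
  assumes n: "n \<ge> 1" and b: "below_top n x"
  shows "position n (shift x) = (fst (position n x), Suc (snd (position n x)))"
proof -
  obtain a p where ap: "in_tower n x a p" "Suc p < height \<tau> n [a]"
    using b by (auto simp: below_top_def)
  have "in_tower n (shift x) a (Suc p)"
    using ap unfolding in_tower_def by (auto simp: image_iff)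
  then show ?thesis using position_eqI[OF n] ap(1) by simp
qed

end

section \<open>Summable errors give an eigenfunction\<close>

locale summable_prefix_errors = recognizable_directive_sequence +
  fixes \<alpha> :: real and \<rho> :: "nat \<Rightarrow> 'a \<Rightarrow> real"
  assumes summable_errors: "summable (\<lambda>n. Max (prefix_errors \<alpha> \<rho> n))"
begin

definition max_error :: "nat \<Rightarrow> real" where
  "max_error n = Max (prefix_errors \<alpha> \<rho> n)"

lemma prefix_error_le:
  assumes "c \<in> A (n + 2)" "k < length (\<tau> n (\<tau> (n + 1) [c]))" and W: "W = \<tau> n (\<tau> (n + 1) [c])"
  shows "int_dist (\<rho> n (W ! 0) - \<rho> n (W ! k) + \<alpha> * real (height \<tau> n (take k W))) \<le> max_error n"
  unfolding max_error_def
proof (rule Max_ge[OF finite_prefix_errors])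
  show "int_dist (\<rho> n (W ! 0) - \<rho> n (W ! k) + \<alpha> * real (height \<tau> n (take k W))) \<in> prefix_errors \<alpha> \<rho> n"
    unfolding prefix_errors_eq using assms by (intro image_eqI[of _ _ "(c, k)"]) (auto simp: Let_def)
qed

lemma first_letter_in: "b \<in> A (Suc n) \<Longrightarrow> \<tau> n [b] ! 0 \<in> A n"
proof -
  assume b: "b \<in> A (Suc n)"
  then have "0 < length (\<tau> n [b])" using length_\<tau>_letter[OF b] by linarith
  then show ?thesis using \<tau>_letter_lists[OF b] by (simp add: in_lists_conv_set)
qed

text \<open>
  The lists \<open>\<rho> n\<close> and \<open>\<rho> (n + 1)\<close> are unrelated a priori, but both bounds on errors control the
  differences between two letters \<open>b\<close> and \<open>d\<close> of level \<open>n + 1\<close> by the same height: with \<open>V = \<tau> (n + 1) [c]\<close>,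
  the passage from the first letter \<open>d\<close> of \<open>V\<close> to an occurrence of \<open>b\<close> is seen at level \<open>n + 1\<close> in \<open>V\<close>
  and at level \<open>n\<close> in \<open>\<tau> n V\<close>. The letter \<open>c\<close> is chosen as the first letter of some
  \<open>\<tau> (n + 2) [c']\<close> because errors of level \<open>n + 1\<close> are measured along prefixes of
  \<open>\<tau> (n + 1) (\<tau> (n + 2) [c'])\<close>.
\<close>

lemma first_letter_comparison:
  obtains \<kappa> where "\<And>b. b \<in> A (Suc n) \<Longrightarrow>
    int_dist (\<rho> (Suc n) b - \<rho> n (\<tau> n [b] ! 0) - \<kappa>) \<le> max_error n + max_error (Suc n)"
proof -
  obtain c' where c': "c' \<in> A (Suc (Suc (Suc n)))" using alphabet_nonempty by blast
  define U where "U = \<tau> (Suc (Suc n)) [c']"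
  define c where "c = U ! 0"
  define V where "V = \<tau> (Suc n) [c]"
  define d where "d = V ! 0"
  have U: "U \<in> lists (A (Suc (Suc n)))" "0 < length U"
    using c' \<tau>_letter_lists length_\<tau>_letter[OF c'] by (auto simp: U_def)
  have c: "c \<in> A (Suc (Suc n))" using c' by (simp add: c_def U_def first_letter_in)
  have V: "V \<in> lists (A (Suc n))" "0 < length V"
    using c \<tau>_letter_lists length_\<tau>_letter[OF c] by (auto simp: V_def)
  have d: "d \<in> A (Suc n)" using c by (simp add: d_def V_def first_letter_in)
  have "int_dist (\<rho> (Suc n) b - \<rho> n (\<tau> n [b] ! 0) - (\<rho> (Suc n) d - \<rho> n (\<tau> n [d] ! 0))) \<le> max_error n + max_error (Suc n)"
    if b: "b \<in> A (Suc n)" for b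
  proof -
    obtain j where j: "j < length V" "V ! j = b"
      using \<tau>_positive[OF b c] by (metis V_def in_set_conv_nth)
    define W' where "W' = \<tau> (Suc n) U"
    have pos: "k < length W' \<and> W' ! k = V ! k \<and> take k W' = take k V" if "k < length V" for k
      using substitution_prefix_of_position[OF substitution_\<tau> U, of k] that substitution_Nil[OF substitution_\<tau>]
      by (simp add: W'_def c_def[symmetric] V_def[symmetric])
    have e1: "int_dist (\<rho> (Suc n) d - \<rho> (Suc n) b + \<alpha> * real (height \<tau> (Suc n) (take j V))) \<le> max_error (Suc n)"
      using prefix_error_le[of c' "Suc n" j W'] pos[OF V(2)] pos[OF j(1)] c' j(2)
      by (simp add: W'_def U_def d_def)
    define W where "W = \<tau> n V"
    define t where "t = length (\<tau> n (take j V))"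
    have "0 < length (\<tau> n [b])" "0 < length (\<tau> n [d])" using length_\<tau>_letter b d by fastforce+
    then have t: "t < length W" "W ! t = \<tau> n [b] ! 0" "take t W = \<tau> n (take j V)" "W ! 0 = \<tau> n [d] ! 0"
      using substitution_prefix_of_position[OF substitution_\<tau> V(1) j(1), of 0]
        substitution_prefix_of_position[OF substitution_\<tau> V(1) V(2), of 0]
        substitution_Nil[OF substitution_\<tau>, of n] j(2)
      by (simp_all add: t_def W_def d_def)
    have e2: "int_dist (\<rho> n (\<tau> n [d] ! 0) - \<rho> n (\<tau> n [b] ! 0) + \<alpha> * real (height \<tau> (Suc n) (take j V))) \<le> max_error n"
      using prefix_error_le[of c n t W] t c by (simp add: W_def V_def height_Suc)
    have "\<rho> (Suc n) b - \<rho> n (\<tau> n [b] ! 0) - (\<rho> (Suc n) d - \<rho> n (\<tau> n [d] ! 0))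
      = (\<rho> n (\<tau> n [d] ! 0) - \<rho> n (\<tau> n [b] ! 0) + \<alpha> * real (height \<tau> (Suc n) (take j V)))
      - (\<rho> (Suc n) d - \<rho> (Suc n) b + \<alpha> * real (height \<tau> (Suc n) (take j V)))"
      by simp
    then show ?thesis using int_dist_triangle_diff e1 e2 by (smt (verit))
  qed
  then show ?thesis using that by blast
qed

text \<open>
  By positivity \<open>\<tau> n [b]\<close> occurs in the image \<open>\<tau> n (\<tau> (n + 1) [c])\<close> of any \<open>c\<close>; the error between
  two of its letters is the difference of two errors measured from the beginning of that image.
\<close>

lemma column_error:
  assumes b: "b \<in> A (Suc n)" and i: "i < length (\<tau> n [b])"
  shows "int_dist (\<rho> n (\<tau> n [b] ! 0) - \<rho> n (\<tau> n [b] ! i) + \<alpha> * real (height \<tau> n (take i (\<tau> n [b])))) \<le> 2 * max_error n"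
proof -
  obtain c where c: "c \<in> A (Suc (Suc n))" using alphabet_nonempty by blast
  define V where "V = \<tau> (Suc n) [c]"
  have V: "V \<in> lists (A (Suc n))" using c \<tau>_letter_lists by (simp add: V_def)
  obtain j where j: "j < length V" "V ! j = b"
    using \<tau>_positive[OF b c] by (metis V_def in_set_conv_nth)
  define W where "W = \<tau> n V"
  define t where "t = length (\<tau> n (take j V))"
  have h: "height \<tau> n (\<tau> n (take j V) @ take k (\<tau> n [b])) = height \<tau> n (\<tau> n (take j V)) + height \<tau> n (take k (\<tau> n [b]))" for k
    using V \<tau>_lists[of "take j V" n] \<tau>_letter_lists[OF b]
    by (intro height_append) (auto simp: in_lists_conv_set dest: in_set_takeD)
  have e: "int_dist (\<rho> n (W ! 0) - \<rho> n (\<tau> n [b] ! k)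
      + \<alpha> * real (height \<tau> n (\<tau> n (take j V)) + height \<tau> n (take k (\<tau> n [b])))) \<le> max_error n"
    if "k < length (\<tau> n [b])" for k
    using prefix_error_le[of c n "t + k" W] c that
      substitution_prefix_of_position[OF substitution_\<tau> V j(1), of k] j(2)
    by (simp add: W_def V_def t_def h[unfolded V_def])
  define H where "H = height \<tau> n (\<tau> n (take j V))"
  have z: "height \<tau> n (take 0 (\<tau> n [b])) = 0" by (simp add: height_def substitution_Nil[OF substitution_\<sigma>])
  have "0 < length (\<tau> n [b])" using i by linarith
  then have "int_dist (\<rho> n (W ! 0) - \<rho> n (\<tau> n [b] ! 0) + \<alpha> * real H) \<le> max_error n"
    using e[of 0] unfolding z H_def by simp
  moreover have "\<rho> n (\<tau> n [b] ! 0) - \<rho> n (\<tau> n [b] ! i) + \<alpha> * real (height \<tau> n (take i (\<tau> n [b])))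
    = (\<rho> n (W ! 0) - \<rho> n (\<tau> n [b] ! i) + \<alpha> * real (H + height \<tau> n (take i (\<tau> n [b]))))
     - (\<rho> n (W ! 0) - \<rho> n (\<tau> n [b] ! 0) + \<alpha> * real H)"
    by (simp add: algebra_simps)
  ultimately show ?thesis
    using e[OF i, folded H_def] int_dist_triangle_diff by (smt (verit))
qed

definition level_offset :: "nat \<Rightarrow> real" where
  "level_offset n = (SOME \<kappa>. \<forall>b\<in>A (Suc n). int_dist (\<rho> (Suc n) b - \<rho> n (\<tau> n [b] ! 0) - \<kappa>) \<le> max_error n + max_error (Suc n))"

lemma level_offset: "b \<in> A (Suc n) \<Longrightarrow> int_dist (\<rho> (Suc n) b - \<rho> n (\<tau> n [b] ! 0) - level_offset n) \<le> max_error n + max_error (Suc n)"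
proof -
  have "\<exists>\<kappa>. \<forall>b\<in>A (Suc n). int_dist (\<rho> (Suc n) b - \<rho> n (\<tau> n [b] ! 0) - \<kappa>) \<le> max_error n + max_error (Suc n)"
    by (rule first_letter_comparison[of n]) blast
  from someI_ex[OF this] show "b \<in> A (Suc n) \<Longrightarrow> ?thesis" unfolding level_offset_def by blast
qed

text \<open>
  The real value that \<open>\<rho> n\<close> and \<open>\<alpha>\<close> prescribe at \<open>x\<close>. The accumulated offsets align the levels, since
  \<open>\<rho> n\<close> may be changed by an additive constant at each level without affecting the errors.
\<close>

definition finite_level_value :: "nat \<Rightarrow> (int \<Rightarrow> 'a) \<Rightarrow> real" where
  "finite_level_value n x = \<rho> n (fst (position n x)) + \<alpha> * real (snd (position n x)) - (\<Sum>i<n. level_offset i)"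

lemma finite_level_value_step:
  assumes n: "n \<ge> 1" and x: "x \<in> level_shift A \<tau> 0"
  shows "int_dist (finite_level_value (Suc n) x - finite_level_value n x) \<le> 3 * max_error n + max_error (Suc n)"
proof -
  obtain b q where bq: "in_tower (Suc n) x b q" using in_tower_exists[OF x] .
  obtain i p where ip: "i < length (\<tau> n [b])" "q = height \<tau> n (take i (\<tau> n [b])) + p" "in_tower n x (\<tau> n [b] ! i) p"
    by (rule in_tower_descend[OF bq])
  have b: "b \<in> A (Suc n)" using bq by (simp add: in_tower_def)
  have eq: "finite_level_value (Suc n) x - finite_level_value n x = (\<rho> (Suc n) b - \<rho> n (\<tau> n [b] ! 0) - level_offset n)
    + (\<rho> n (\<tau> n [b] ! 0) - \<rho> n (\<tau> n [b] ! i) + \<alpha> * real (height \<tau> n (take i (\<tau> n [b]))))"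
    using position_eqI[OF _ bq] position_eqI[OF n ip(3)] by (simp add: finite_level_value_def ip(2) algebra_simps)
  show ?thesis unfolding eq
    using int_dist_triangle[of "\<rho> (Suc n) b - \<rho> n (\<tau> n [b] ! 0) - level_offset n"
        "\<rho> n (\<tau> n [b] ! 0) - \<rho> n (\<tau> n [b] ! i) + \<alpha> * real (height \<tau> n (take i (\<tau> n [b])))"]
      column_error[OF b ip(1)] level_offset[OF b] by linarith
qed

lemma finite_level_value_limit:
  obtains G where "\<And>e. e > 0 \<Longrightarrow> \<exists>n\<ge>1. \<forall>m\<ge>n. \<forall>x\<in>level_shift A \<tau> 0. int_dist (G x - finite_level_value m x) < e"
proof -
  define E where "E = (\<lambda>n. 3 * max_error (Suc n) + max_error (Suc (Suc n)))"
  have max_error: "summable max_error" using summable_errors by (simp add: max_error_def[abs_def])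
  have E: "summable E" unfolding E_def
    using max_error summable_Suc_iff[of max_error] summable_Suc_iff[of "\<lambda>n. max_error (Suc n)"]
    by (intro summable_add summable_mult) blast+
  have "\<exists>G. \<forall>n. int_dist (G - finite_level_value (Suc n) x) \<le> (\<Sum>i. E (i + n))" if "x \<in> level_shift A \<tau> 0" for x
  proof -
    have "int_dist (finite_level_value (Suc (Suc n)) x - finite_level_value (Suc n) x) \<le> E n" for n
      using finite_level_value_step[OF _ that, of "Suc n"] by (simp add: E_def)
    then show ?thesis by (rule circle_series_limit[OF E, of "\<lambda>n. finite_level_value (Suc n) x"]) blast
  qed
  then obtain G where G: "\<And>x n. x \<in> level_shift A \<tau> 0 \<Longrightarrow> int_dist (G x - finite_level_value (Suc n) x) \<le> (\<Sum>i. E (i + n))"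
    by metis
  have "\<exists>n\<ge>1. \<forall>m\<ge>n. \<forall>x\<in>level_shift A \<tau> 0. int_dist (G x - finite_level_value m x) < e" if e: "e > 0" for e
  proof -
    obtain N where N: "\<And>n. n \<ge> N \<Longrightarrow> norm (\<Sum>i. E (i + n)) < e"
      using suminf_exist_split[OF e E] by blast
    have "int_dist (G x - finite_level_value m x) < e" if m: "m \<ge> Suc N" and x: "x \<in> level_shift A \<tau> 0" for m x
    proof -
      obtain k where "m = Suc k" "k \<ge> N" using m by (cases m) auto
      then show ?thesis using G[OF x, of k] N[of k] by simp
    qed
    then show ?thesis by (intro exI[of _ "Suc N"]) auto
  qed
  then show ?thesis using that by blast
qed

text \<open>
  The limit function is nearly constant on cylinders because \<open>finite_level_value n\<close> is constant on them.
  For the eigenvalue equation at \<open>x\<close>, a nearby point \<open>y\<close> below the top of some tower is used: from that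
  level on \<open>finite_level_value\<close> increases by exactly \<open>\<alpha>\<close> between \<open>y\<close> and \<open>shift y\<close>.
\<close>

lemma eigenfunction_exists:
  obtains g :: "(int \<Rightarrow> 'a) \<Rightarrow> circle" where
    "\<And>x e. x \<in> level_shift A \<tau> 0 \<Longrightarrow> e > 0 \<Longrightarrow>
      \<exists>N. \<forall>y\<in>level_shift A \<tau> 0. agree N x y \<longrightarrow> \<bar>centered_lift (g y - g x)\<bar> < e"
    "\<And>x. x \<in> level_shift A \<tau> 0 \<Longrightarrow> g (shift x) = g x + circle_of \<alpha>"
proof -
  obtain G where G: "\<And>e. e > 0 \<Longrightarrow> \<exists>n\<ge>1. \<forall>m\<ge>n. \<forall>x\<in>level_shift A \<tau> 0. int_dist (G x - finite_level_value m x) < e"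
    using finite_level_value_limit by blast
  have near: "\<exists>N. \<forall>y\<in>level_shift A \<tau> 0. agree N x y \<longrightarrow> int_dist (G y - G x) < e"
    if x: "x \<in> level_shift A \<tau> 0" and e: "e > 0" for x e
  proof -
    obtain n where n: "n \<ge> 1" "\<And>x. x \<in> level_shift A \<tau> 0 \<Longrightarrow> int_dist (G x - finite_level_value n x) < e / 2"
      using G[of "e / 2"] e by auto
    obtain N where N: "\<And>y. y \<in> level_shift A \<tau> 0 \<Longrightarrow> agree N x y \<Longrightarrow> position n y = position n x"
      using position_locally_constant[OF n(1) x] by blast
    have "int_dist (G y - G x) < e" if y: "y \<in> level_shift A \<tau> 0" "agree N x y" for y
    proof -
      have "finite_level_value n y = finite_level_value n x" using N[OF y] by (simp add: finite_level_value_def)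
      then show ?thesis
        using int_dist_triangle_diff[of "G y - finite_level_value n y" "G x - finite_level_value n x"] n(2)[OF y(1)] n(2)[OF x] by simp
    qed
    then show ?thesis by blast
  qed
  have "int_dist (G (shift x) - G x - \<alpha>) = 0" if x: "x \<in> level_shift A \<tau> 0" for x
  proof (rule ccontr)
    assume "int_dist (G (shift x) - G x - \<alpha>) \<noteq> 0"
    then have e0: "int_dist (G (shift x) - G x - \<alpha>) > 0"
      using int_dist_nonneg[of "G (shift x) - G x - \<alpha>"] by linarith
    \<comment> \<open>Four comparisons are made: \<open>x\<close> with \<open>y\<close> and \<open>G\<close> with \<open>finite_level_value\<close>, each also after a shift.\<close>
    define e where "e = int_dist (G (shift x) - G x - \<alpha>) / 4"
    have e: "e > 0" using e0 by (simp add: e_def)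
    obtain N1 where N1: "\<And>y. y \<in> level_shift A \<tau> 0 \<Longrightarrow> agree N1 x y \<Longrightarrow> int_dist (G y - G x) < e"
      using near[OF x e] by blast
    obtain N2 where N2: "\<And>y. y \<in> level_shift A \<tau> 0 \<Longrightarrow> agree N2 (shift x) y \<Longrightarrow> int_dist (G y - G (shift x)) < e"
      using near[OF level_shift_0_shift[OF x] e] by blast
    obtain y m where y: "y \<in> level_shift A \<tau> 0" "agree (N1 + N2 + 1) x y" "m \<ge> 1" "below_top m y"
      by (rule below_top_dense[OF x])
    have Sy: "shift y \<in> level_shift A \<tau> 0" by (rule level_shift_0_shift[OF y(1)])
    have a: "agree N1 x y" "agree N2 (shift x) (shift y)"
      using y(2) by (auto simp: agree_def shift_def)
    obtain n where n: "n \<ge> 1" "\<And>k x. k \<ge> n \<Longrightarrow> x \<in> level_shift A \<tau> 0 \<Longrightarrow> int_dist (G x - finite_level_value k x) < e"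
      using G[OF e] by blast
    define k where "k = max m n"
    have k: "k \<ge> 1" "k \<ge> n" "k \<ge> m" using n(1) by (auto simp: k_def)
    have "finite_level_value k (shift y) = finite_level_value k y + \<alpha>"
      using position_shift[OF k(1) below_top_mono[OF k(3) y(3,1,4)]] by (simp add: finite_level_value_def algebra_simps)
    then have eq: "G (shift x) - G x - \<alpha> = ((G (shift y) - finite_level_value k (shift y)) - (G (shift y) - G (shift x)))
        - ((G y - finite_level_value k y) - (G y - G x))" by simp
    have "int_dist (G (shift x) - G x - \<alpha>) \<le> int_dist (G (shift y) - finite_level_value k (shift y)) + int_dist (G (shift y) - G (shift x))
        + (int_dist (G y - finite_level_value k y) + int_dist (G y - G x))"
      unfolding eq using int_dist_triangle_diff[of "G (shift y) - finite_level_value k (shift y)" "G (shift y) - G (shift x)"]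
        int_dist_triangle_diff[of "G y - finite_level_value k y" "G y - G x"]
        int_dist_triangle_diff[of "(G (shift y) - finite_level_value k (shift y)) - (G (shift y) - G (shift x))"
          "(G y - finite_level_value k y) - (G y - G x)"] by linarith
    also have "\<dots> < e + e + (e + e)"
      using N1[OF y(1) a(1)] N2[OF Sy a(2)] n(2)[OF k(2) y(1)] n(2)[OF k(2) Sy] by linarith
    finally show False by (simp add: e_def)
  qed
  then have "circle_of (G (shift x)) = circle_of (G x) + circle_of \<alpha>" if "x \<in> level_shift A \<tau> 0" for x
    using that by (simp add: circle_of_add[symmetric] circle_of_eq_iff int_dist_eq_0_iff algebra_simps)
  then show ?thesis
    using that[of "\<lambda>x. circle_of (G x)"] near by (simp add: circle_of_diff[symmetric] abs_centered_lift)
qed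

end

theorem theorem4p2:
  fixes A :: "nat \<Rightarrow> 'a set"
    and \<tau> :: "nat \<Rightarrow> 'a list \<Rightarrow> 'a list"
    and X :: "(int \<Rightarrow> 'a) set"
    and \<alpha> :: real
  assumes "directive_sequence A \<tau>"
    and "recognizable A \<tau>"
    and "positive_seq A \<tau>"
    and "subshift (A 0) X"
    and "generates A \<tau> X"
  shows "continuous_eigenvalue (A 0) X \<alpha> \<longleftrightarrow>
    (\<exists>\<rho> :: nat \<Rightarrow> 'a \<Rightarrow> real.
       summable (\<lambda>n. Max {int_dist (\<rho> n (u ! 0) - \<rho> n (u ! k) + \<alpha> * real (height \<tau> n (take k u))) | a u k.
         a \<in> A (n + 2) \<and> u \<in> lists (A n) \<and> length u = k + 1 \<and> prefix u (\<tau> n (\<tau> (n + 1) [a]))}))"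
proof -
  interpret recognizable_directive_sequence A \<tau>
    by standard fact+
  have X: "X = level_shift A \<tau> 0" using assms(5) by (simp add: generates_def)
  have cont: "continuous_map (subtopology (full_shift (A 0)) (level_shift A \<tau> 0)) euclidean g \<longleftrightarrow>
      (\<forall>x\<in>level_shift A \<tau> 0. \<forall>e>0. \<exists>N. \<forall>y\<in>level_shift A \<tau> 0.
        agree N x y \<longrightarrow> \<bar>centered_lift (g y - g x)\<bar> < e)" for g :: "(int \<Rightarrow> 'a) \<Rightarrow> circle"
    by (rule continuous_map_circle_iff) (rule level_shift_range)
  have "continuous_eigenvalue (A 0) X \<alpha> \<longleftrightarrow> (\<exists>\<rho>. summable (\<lambda>n. Max (prefix_errors \<alpha> \<rho> n)))"
  proof
    assume "continuous_eigenvalue (A 0) X \<alpha>"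
    then obtain g :: "(int \<Rightarrow> 'a) \<Rightarrow> circle"
      where g: "\<And>x e. x \<in> level_shift A \<tau> 0 \<Longrightarrow> e > 0 \<Longrightarrow>
          \<exists>N. \<forall>y\<in>level_shift A \<tau> 0. agree N x y \<longrightarrow> \<bar>centered_lift (g y - g x)\<bar> < e"
        and eig: "\<And>x. x \<in> level_shift A \<tau> 0 \<Longrightarrow> g (shift x) = g x + circle_of \<alpha>"
      unfolding continuous_eigenvalue_def X cont by blast
    obtain N where N: "\<And>n a v w. n \<ge> N \<Longrightarrow> v \<in> tower_base A \<tau> n a \<Longrightarrow> w \<in> tower_base A \<tau> n a \<Longrightarrow>
        \<bar>centered_lift (g v - g w)\<bar> < 1 / 16"
      using eigenfunction_tower_base[of g \<alpha> "1 / 16", OF g eig] by force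
    interpret eigenfunction_small_on_bases A \<tau> g \<alpha> N
      by standard (fact eig, fact N)
    show "\<exists>\<rho>. summable (\<lambda>n. Max (prefix_errors \<alpha> \<rho> n))" using summable_prefix_errors_top_value by blast
  next
    assume "\<exists>\<rho>. summable (\<lambda>n. Max (prefix_errors \<alpha> \<rho> n))"
    then obtain \<rho> where \<rho>: "summable (\<lambda>n. Max (prefix_errors \<alpha> \<rho> n))" by blast
    interpret summable_prefix_errors A \<tau> \<alpha> \<rho> by standard (fact \<rho>)
    obtain g :: "(int \<Rightarrow> 'a) \<Rightarrow> circle" where
      "\<And>x e. x \<in> level_shift A \<tau> 0 \<Longrightarrow> e > 0 \<Longrightarrow>
        \<exists>N. \<forall>y\<in>level_shift A \<tau> 0. agree N x y \<longrightarrow> \<bar>centered_lift (g y - g x)\<bar> < e"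
      "\<And>x. x \<in> level_shift A \<tau> 0 \<Longrightarrow> g (shift x) = g x + circle_of \<alpha>"
      using eigenfunction_exists by blast
    then show "continuous_eigenvalue (A 0) X \<alpha>"
      unfolding continuous_eigenvalue_def X cont by blast
  qed
  then show ?thesis by (simp only: prefix_errors_def)
qed

end
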